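(* Let $\alpha\ge0$, $0\le\beta<1$, and $f=h+\overline{g}\in\mathcal{W}_{\mathcal{H}}^0(\alpha,\beta)$. (i) For $q>2$, $s_{2,q}(f)$ is a convex harmonic mapping in the disk $|z|<R_1$, where $R_1$ is the smallest positive root in $(0,1)$ of $$1-4r+(6\beta-2)r^2-8(1-\beta)r^3+(1-2\beta)r^4+4(1-\beta)r^5=0.$$ (ii) For $p>2$, $s_{p,2}(f)$ is a convex harmonic mapping in the disk $|z|<R_2$, where $R_2$ is the smallest positive root in $(0,1)$ of $$1-4r+(1-\beta)r^2-(8-3\beta)r^3-(5-2\beta)r^4-(4-3\beta)r^5+3(1-\beta)r^6=0.$$
   Context: Let $\mathbb{D}=\{z\in\mathbb{C}:|z|<1\}$. $\mathcal{H}^0$ denotes the class of harmonic maps $f=h+\overline{g}$ on $\mathbb{D}$, with $h,g$ analytic in $\mathbb{D}$, $h(z)=z+\sum_{n\ge2}a_nz^n$ and $g(z)=\sum_{n\ge2}b_nz^n$. For $\alpha\ge0$, $0\le\beta<1$, $\mathcal{W}_{\mathcal{H}}^0(\alpha,\beta)$ denotes the class of $f=h+\overline{g}\in\mathcal{H}^0$ such that $\Re\big(h'(z)+\alpha zh''(z)-\beta\big)>|g'(z)+\alpha zg''(z)|$ for all $z\in\mathbb{D}$. For integers $p,q\ge1$, $s_{p,q}(f)=s_p(h)+\overline{s_q(g)}$ with $s_p(h)(z)=z+\sum_{k=2}^pa_kz^k$ and $s_q(g)(z)=\sum_{k=2}^qb_kz^k$. A harmonic map is convex in a disk if it is univalent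 there and maps the disk onto a convex domain. *)

theory Defs
  imports "HOL-Analysis.Analysis"
begin

definition taylor_coef :: "(complex \<Rightarrow> complex) \<Rightarrow> nat \<Rightarrow> complex" where
  "taylor_coef h n = (deriv ^^ n) h 0 / of_nat (fact n)"

definition harmonic_H0 :: "(complex \<Rightarrow> complex) \<Rightarrow> (complex \<Rightarrow> complex) \<Rightarrow> bool" where
  "harmonic_H0 h g \<longleftrightarrow>
     h holomorphic_on ball 0 1 \<and> g holomorphic_on ball 0 1 \<and>
     h 0 = 0 \<and> deriv h 0 = 1 \<and> g 0 = 0 \<and> deriv g 0 = 0"

definition W_H0 :: "real \<Rightarrow> real \<Rightarrow> (complex \<Rightarrow> complex) \<Rightarrow> (complex \<Rightarrow> complex) \<Rightarrow> bool" where
  "W_H0 \<alpha> \<beta> h g \<longleftrightarrow> harmonic_H0 h g \<and>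
     (\<forall>z\<in>ball 0 1.
        cmod (deriv g z + of_real \<alpha> * z * deriv (deriv g) z)
        < Re (deriv h z + of_real \<alpha> * z * deriv (deriv h) z - of_real \<beta>))"

definition sec_h :: "nat \<Rightarrow> (complex \<Rightarrow> complex) \<Rightarrow> complex \<Rightarrow> complex" where
  "sec_h p h z = z + (\<Sum>k=2..p. taylor_coef h k * z ^ k)"

definition sec_g :: "nat \<Rightarrow> (complex \<Rightarrow> complex) \<Rightarrow> complex \<Rightarrow> complex" where
  "sec_g q g z = (\<Sum>k=2..q. taylor_coef g k * z ^ k)"

definition sec_pq :: "nat \<Rightarrow> nat \<Rightarrow> (complex \<Rightarrow> complex) \<Rightarrow> (complex \<Rightarrow> complex) \<Rightarrow> complex \<Rightarrow> complex" where
  "sec_pq p q h g z = sec_h p h z + cnj (sec_g q g z)"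

definition convex_in_disk :: "(complex \<Rightarrow> complex) \<Rightarrow> real \<Rightarrow> bool" where
  "convex_in_disk F R \<longleftrightarrow> inj_on F (ball 0 R) \<and> convex (F ` ball 0 R)"

definition P1 :: "real \<Rightarrow> real \<Rightarrow> real" where
  "P1 \<beta> r = 1 - 4*r + (6*\<beta> - 2)*r^2 - 8*(1-\<beta>)*r^3 + (1 - 2*\<beta>)*r^4 + 4*(1-\<beta>)*r^5"

definition P2 :: "real \<Rightarrow> real \<Rightarrow> real" where
  "P2 \<beta> r = 1 - 4*r + (1-\<beta>)*r^2 - (8 - 3*\<beta>)*r^3 - (5 - 2*\<beta>)*r^4 - (4 - 3*\<beta>)*r^5
            + 3*(1-\<beta>)*r^6"

definition smallest_root_01 :: "(real \<Rightarrow> real) \<Rightarrow> real \<Rightarrow> bool" where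
  "smallest_root_01 P R \<longleftrightarrow> 0 < R \<and> R < 1 \<and> P R = 0 \<and> (\<forall>r. 0 < r \<and> r < R \<longrightarrow> P r \<noteq> 0)"

end

theory Submission
  imports Defs "HOL-Complex_Analysis.Complex_Analysis"
begin

text \<open>
  For \<open>F = H + cnj G\<close> with \<open>Re H' > |G'|\<close> on a disc, the tangent of the image of each circle has an argument
  that can be followed by the principal logarithm; if it increases, the image curve lies on one side of
  each of its tangents and bounds a convex domain. This turns convexity into the pointwise inequality
  \<open>|A - C + cnj (B + D)| < |A + C + cnj (B - D)|\<close> with \<open>A = z (z H')'\<close>, \<open>B = z (z G')'\<close>, \<open>C = z H'\<close>, \<open>D = z G'\<close>.

  The class reduces to \<open>\<alpha> = 0\<close>, that is to \<open>|q| < Re (P - \<beta>)\<close> for \<open>P = h'\<close> and \<open>q = g'\<close>. Besides the bounds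
  \<open>|p\<^sub>n| + |q\<^sub>n| \<le> 2 (1 - \<beta>)\<close> and \<open>|q\<^sub>n| \<le> 1 - \<beta>\<close> on the Taylor coefficients, one needs for \<open>\<beta> = 0\<close> that
  \<open>|q\<^sub>1| \<le> 1 - |w\<^sub>1|\<^sup>2 - |w\<^sub>2|\<^sup>2\<close>, where \<open>w = (P - 1) / (P + 1)\<close>, and a similar bound on \<open>q\<^sub>2\<close>.
  The first root of \<open>P2\<close> is always below \<open>0.234\<close>, where part (ii) holds with \<open>\<beta> = 0\<close>; part (i) combines the
  positivity of \<open>P1\<close> for \<open>r \<ge> 0.213\<close> with the refined bounds for smaller \<open>r\<close>.
\<close>

subsection \<open>Convexity of harmonic images of discs\<close>

text \<open>Polarisation: it trades the sign of an angular velocity for a comparison of moduli, to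
  which triangle inequalities apply.\<close>

lemma Re_mult_cnj_pos_iff: "0 < Re (x * cnj y) \<longleftrightarrow> cmod (x - y) < cmod (x + y)"
proof -
  have "(cmod (x + y))\<^sup>2 - (cmod (x - y))\<^sup>2 = 4 * Re (x * cnj y)"
    unfolding cmod_power2 by (simp add: algebra_simps power2_eq_square)
  moreover have "cmod (x - y) < cmod (x + y) \<longleftrightarrow> (cmod (x - y))\<^sup>2 < (cmod (x + y))\<^sup>2"
    by (simp add: power_mono_iff abs_le_square_iff flip: not_le)
  ultimately show ?thesis by linarith
qed

lemma has_vector_derivative_cis:
  "((\<lambda>t. cis (c * t)) has_vector_derivative of_real c * (\<i> * cis (c * t))) (at t)"
  unfolding has_vector_derivative_def
  by (rule derivative_eq_intros refl | simp add: algebra_simps scaleR_conv_of_real)+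

text \<open>The maximum modulus principle is applied to \<open>exp (\<Phi> z)\<close>, whose modulus
  is \<open>exp (Re (\<Phi> z))\<close>.\<close>

lemma Re_le_of_sphere:
  assumes "\<Phi> holomorphic_on ball 0 R" "0 < r" "r < R"
    and bd: "\<And>z. cmod z = r \<Longrightarrow> Re (\<Phi> z) \<le> c" and z: "cmod z \<le> r"
  shows "Re (\<Phi> z) \<le> c"
proof -
  have sub: "cball 0 r \<subseteq> ball 0 R" using assms by auto
  have hol: "(\<lambda>z. exp (\<Phi> z)) holomorphic_on ball 0 R"
    by (intro holomorphic_intros assms)
  have "cmod (exp (\<Phi> z)) \<le> exp c"
  proof (rule maximum_modulus_frontier[where S = "cball 0 r" and f = "\<lambda>z. exp (\<Phi> z)"])
    show "(\<lambda>z. exp (\<Phi> z)) holomorphic_on interior (cball 0 r)"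
      using holomorphic_on_subset[OF hol] sub interior_subset by blast
    show "continuous_on (closure (cball 0 r)) (\<lambda>z. exp (\<Phi> z))"
      using holomorphic_on_imp_continuous_on[OF hol] sub continuous_on_subset by auto
    show "\<And>z. z \<in> frontier (cball 0 r) \<Longrightarrow> cmod (exp (\<Phi> z)) \<le> exp c"
      using bd by (auto simp: frontier_cball)
  qed (use z in auto)
  then show ?thesis by simp
qed

text \<open>Moving from \<open>a\<close> in the direction \<open>cnj n\<close> increases
  \<open>Re (n * w)\<close>, so an open set inside the half plane cannot touch its boundary
  line.\<close>

lemma Re_less_of_open_subset:
  assumes "open V" "V \<subseteq> {w. Re (n * w) \<le> c}" "a \<in> V" "n \<noteq> 0"
  shows "Re (n * a) < c"
proof (rule ccontr)
  assume "\<not> Re (n * a) < c"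
  then have "Re (n * a) = c" using assms by force
  obtain d where d: "d > 0" "ball a d \<subseteq> V" using assms(1,3) open_contains_ball by blast
  define b where "b = a + of_real (d / (2 * cmod n)) * cnj n"
  have "dist a b = d / 2" using d assms(4) by (simp add: b_def dist_norm norm_mult norm_divide)
  then have "b \<in> V" using d by auto
  then have "Re (n * b) \<le> c" using assms(2) by auto
  moreover have "n * b = n * a + of_real (d / (2 * cmod n) * (cmod n)\<^sup>2)"
    unfolding b_def of_real_mult complex_norm_square by (simp add: algebra_simps)
  moreover have "d / (2 * cmod n) * (cmod n)\<^sup>2 > 0" using d assms(4) by simp
  ultimately show False using \<open>Re (n * a) = c\<close> by simp
qed

text \<open>With \<open>x = z (z H')' + cnj (z (z G')')\<close> and
  \<open>y = z H' - cnj (z G')\<close>, the condition \<open>curvature\<close> reads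
  \<open>|x - y| < |x + y|\<close>, that is \<open>Re (x * cnj y) > 0\<close>: tangents to the
  images of circles turn counterclockwise. At the centre both sides vanish.\<close>

locale harmonic_disc =
  fixes H H1 H2 G G1 G2 :: "complex \<Rightarrow> complex" and R :: real
  assumes H1: "\<And>z. z \<in> ball 0 R \<Longrightarrow> (H has_field_derivative H1 z) (at z)"
    and H2: "\<And>z. z \<in> ball 0 R \<Longrightarrow> (H1 has_field_derivative H2 z) (at z)"
    and G1: "\<And>z. z \<in> ball 0 R \<Longrightarrow> (G has_field_derivative G1 z) (at z)"
    and G2: "\<And>z. z \<in> ball 0 R \<Longrightarrow> (G1 has_field_derivative G2 z) (at z)"
    and Re_pos: "\<And>z. z \<in> ball 0 R \<Longrightarrow> cmod (G1 z) < Re (H1 z)"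
    and curvature: "\<And>z. \<lbrakk>z \<in> ball 0 R; z \<noteq> 0\<rbrakk> \<Longrightarrow>
      cmod (z\<^sup>2 * H2 z + cnj (2 * z * G1 z + z\<^sup>2 * G2 z))
      < cmod (2 * z * H1 z + z\<^sup>2 * H2 z + cnj (z\<^sup>2 * G2 z))"
begin

definition F :: "complex \<Rightarrow> complex" where "F z = H z + cnj (G z)"

lemma hol: "H holomorphic_on ball 0 R" "G holomorphic_on ball 0 R"
  using H1 G1 by (meson field_differentiable_at_within field_differentiable_def holomorphic_on_def)+

lemma cont: "continuous_on (ball 0 R) F"
  unfolding F_def by (intro continuous_intros holomorphic_on_imp_continuous_on hol)

text \<open>Noshiro-Warschawski argument: along a segment in direction \<open>d\<close>, the
  derivative of \<open>Re (cnj d * F)\<close> is at least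
  \<open>|d|\<^sup>2 (Re H1 - |G1|) > 0\<close>.\<close>

lemma inj: "inj_on F (ball 0 R)"
proof (rule inj_onI, rule ccontr)
  fix x y assume xy: "x \<in> ball 0 R" "y \<in> ball 0 R" "F x = F y" "x \<noteq> y"
  define d where "d = y - x"
  have dn: "d \<noteq> 0" using xy by (simp add: d_def)
  have mem: "x + of_real t * d \<in> ball 0 R" if "0 \<le> t" "t \<le> 1" for t
  proof -
    have "(1 - t) *\<^sub>R x + t *\<^sub>R y \<in> ball 0 R"
      using xy that by (intro convexD[OF convex_ball]) auto
    then show ?thesis by (simp add: d_def scaleR_conv_of_real algebra_simps)
  qed
  have "Re (cnj d * F (x + of_real 0 * d)) < Re (cnj d * F (x + of_real 1 * d))"
  proof (rule DERIV_pos_imp_increasing[of 0 1 "\<lambda>t. Re (cnj d * F (x + of_real t * d))"])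
    fix t :: real assume t: "0 \<le> t" "t \<le> 1"
    let ?z = "x + of_real t * d"
    have dz: "((\<lambda>t. x + of_real t * d) has_vector_derivative d) (at t)"
      by (auto intro!: derivative_eq_intros)
    have "((\<lambda>t. cnj d * F (x + of_real t * d)) has_vector_derivative
        cnj d * (d * H1 ?z + cnj (d * G1 ?z))) (at t)"
      unfolding F_def
      using field_vector_diff_chain_at[OF dz H1[OF mem[OF t]]]
        field_vector_diff_chain_at[OF dz G1[OF mem[OF t]]]
      by (auto intro!: derivative_eq_intros simp: o_def)
    then have "((\<lambda>t. Re (cnj d * F (x + of_real t * d))) has_real_derivative
        Re (cnj d * (d * H1 ?z + cnj (d * G1 ?z)))) (at t)"
      by (rule has_field_derivative_Re)
    moreover have "Re (cnj d * (d * H1 ?z + cnj (d * G1 ?z))) > 0"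
    proof -
      have "cnj d * (d * H1 ?z + cnj (d * G1 ?z)) = of_real ((cmod d)\<^sup>2) * H1 ?z + (cnj d)\<^sup>2 * cnj (G1 ?z)"
        unfolding complex_norm_square by (simp add: algebra_simps power2_eq_square)
      moreover have "\<bar>Re ((cnj d)\<^sup>2 * cnj (G1 ?z))\<bar> \<le> (cmod d)\<^sup>2 * cmod (G1 ?z)"
        by (metis abs_Re_le_cmod complex_mod_cnj norm_mult norm_power)
      moreover have "(cmod d)\<^sup>2 * cmod (G1 ?z) < (cmod d)\<^sup>2 * Re (H1 ?z)"
        using Re_pos[OF mem[OF t]] dn by simp
      ultimately show ?thesis by simp
    qed
    ultimately show "\<exists>y. ((\<lambda>t. Re (cnj d * F (x + of_real t * d))) has_real_derivative y) (at t) \<and> y > 0"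
      by blast
  qed simp
  then show False using xy by (simp add: d_def)
qed

lemma open_image: "0 < r \<Longrightarrow> r \<le> R \<Longrightarrow> open (F ` ball 0 r)"
proof -
  assume "0 < r" "r \<le> R"
  then have "ball 0 r \<subseteq> (ball 0 R :: complex set)" by auto
  then show ?thesis
    using cont inj by (intro invariance_of_domain) (auto intro: continuous_on_subset inj_on_subset)
qed

text \<open>The tangent of the image of the circle of radius \<open>r\<close> turns monotonically, exactly once, so
  this curve lies on one side of each of its tangent lines.\<close>

lemma supporting_half_plane:
  assumes r: "0 < r" "r < R" and w: "cmod w = r"
  shows "\<exists>n. n \<noteq> 0 \<and> (\<forall>z. cmod z = r \<longrightarrow> Re (n * F z) \<le> Re (n * F w))"
proof -
  define z where "z t = of_real r * cis t" for t
  \<comment> \<open>\<open>W\<close> is the velocity of the image curve and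
    \<open>v = W / (\<i> * z)\<close>. Since \<open>Re v > 0\<close>, \<open>Ln (v t)\<close> is
    smooth in \<open>t\<close>, and \<open>\<tau> + pi / 2\<close> is a continuous argument of
    \<open>W\<close>.\<close>
  define W where "W t = \<i> * (z t * H1 (z t) - cnj (z t * G1 (z t)))" for t
  define v where "v t = H1 (z t) - cnj (G1 (z t)) * (cis (-t))\<^sup>2" for t
  define \<tau> where "\<tau> t = t + Im (Ln (v t))" for t
  have zm: "z t \<in> ball 0 R" "z t \<noteq> 0" "cmod (z t) = r" for t
    using r by (auto simp: z_def norm_mult)
  have dz: "(z has_vector_derivative \<i> * z t) (at t)" for t
    unfolding z_def[abs_def] using has_vector_derivative_cis[of 1 t]
    by (auto intro!: derivative_eq_intros simp: algebra_simps)
  note dH = field_vector_diff_chain_at[OF dz H1[OF zm(1)], unfolded o_def]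
    and dG = field_vector_diff_chain_at[OF dz G1[OF zm(1)], unfolded o_def]
    and dH1 = field_vector_diff_chain_at[OF dz H2[OF zm(1)], unfolded o_def]
    and dG1 = field_vector_diff_chain_at[OF dz G2[OF zm(1)], unfolded o_def]
  have dF: "((\<lambda>t. F (z t)) has_vector_derivative W t) (at t)" for t
    unfolding F_def W_def using dH dG
    by (auto intro!: derivative_eq_intros simp: algebra_simps)
  have dW: "(W has_vector_derivative - (z t * (H1 (z t) + z t * H2 (z t)) + cnj (z t * (G1 (z t) + z t * G2 (z t))))) (at t)" for t
    unfolding W_def[abs_def] using dH1 dG1 dz
    by (auto intro!: derivative_eq_intros simp: algebra_simps)
  have Wv: "W t = \<i> * z t * v t" for t
    by (simp add: W_def v_def z_def algebra_simps power2_eq_square cis_mult cis_cnj)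
  have vW: "v t = - \<i> / of_real r * (cis (-t) * W t)" for t
  proof -
    have "- \<i> / of_real r * (cis (-t) * W t) = (cis (-t) * cis t) * v t"
      using r by (simp add: Wv z_def mult.left_commute[of "cis (- t)" \<i>])
    then show ?thesis by (simp add: cis_mult)
  qed
  have Rev: "Re (v t) > 0" for t
  proof -
    have "cmod (cnj (G1 (z t)) * (cis (-t))\<^sup>2) = cmod (G1 (z t))"
      by (simp add: norm_mult norm_power)
    then have "Re (cnj (G1 (z t)) * (cis (-t))\<^sup>2) \<le> cmod (G1 (z t))"
      by (metis complex_Re_le_cmod)
    then show ?thesis using Re_pos[OF zm(1)[of t]] by (simp add: v_def)
  qed
  have vn: "v t \<noteq> 0" for t using Rev[of t] by auto
  have Wn: "W t \<noteq> 0" for t using vn zm by (simp add: Wv)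
  \<comment> \<open>The angular velocity of \<open>W\<close> is
    \<open>Im (W' / W) = Re (?x / ?y)\<close>, which has the sign of
    \<open>Re (?x * cnj ?y)\<close>.\<close>
  have Im_pos: "Im (- (z t * (H1 (z t) + z t * H2 (z t)) + cnj (z t * (G1 (z t) + z t * G2 (z t)))) / W t) > 0" for t
  proof -
    let ?x = "z t * (H1 (z t) + z t * H2 (z t)) + cnj (z t * (G1 (z t) + z t * G2 (z t)))"
    let ?y = "z t * H1 (z t) - cnj (z t * G1 (z t))"
    have "0 < Re (?x * cnj ?y)"
      unfolding Re_mult_cnj_pos_iff using curvature[OF zm(1,2)[of t]]
      by (simp add: algebra_simps power2_eq_square)
    moreover have "?y \<noteq> 0" using Wn[of t] by (auto simp: W_def)
    ultimately have "0 < Re (?x / ?y)"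
      by (subst complex_div_cnj) (simp add: Re_divide_of_real del: complex_cnj_add complex_cnj_diff complex_cnj_mult)
    moreover have "- ?x / W t = \<i> * (?x / ?y)" using \<open>?y \<noteq> 0\<close> by (simp add: W_def field_simps)
    ultimately show ?thesis by (simp only: Im_i_times)
  qed
  have d\<tau>: "\<exists>d. (\<tau> has_real_derivative d) (at t) \<and> d > 0" for t
  proof -
    let ?x = "- (z t * (H1 (z t) + z t * H2 (z t)) + cnj (z t * (G1 (z t) + z t * G2 (z t))))"
    have dc: "((\<lambda>t. cis (-t)) has_vector_derivative - \<i> * cis (- t)) (at t)"
      using has_vector_derivative_cis[of "-1" t] by simp
    have "(v has_vector_derivative - \<i> / of_real r * (- \<i> * cis (-t) * W t + cis (-t) * ?x)) (at t)"
      unfolding vW[abs_def] using dW[of t] dc by (auto intro!: derivative_eq_intros)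
    moreover have "(Ln has_field_derivative inverse (v t)) (at (v t))"
      using Rev[of t] by (intro has_field_derivative_Ln) (auto simp: complex_nonpos_Reals_iff)
    ultimately have "((\<lambda>t. Ln (v t)) has_vector_derivative
        (- \<i> / of_real r * (- \<i> * cis (-t) * W t + cis (-t) * ?x)) * inverse (v t)) (at t)"
      using field_vector_diff_chain_at[of v _ t Ln] unfolding o_def by blast
    moreover have "(- \<i> / of_real r * (- \<i> * cis (-t) * W t + cis (-t) * ?x)) * inverse (v t) = ?x / W t - \<i>"
      using r Wn[of t] unfolding vW by (simp add: field_simps)
    ultimately have "((\<lambda>t. Ln (v t)) has_vector_derivative ?x / W t - \<i>) (at t)" by simp
    then have "((\<lambda>t. Im (Ln (v t))) has_real_derivative Im (?x / W t - \<i>)) (at t)"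
      by (rule has_field_derivative_Im)
    then have "(\<tau> has_real_derivative 1 + Im (?x / W t - \<i>)) (at t)"
      unfolding \<tau>_def[abs_def] by (intro DERIV_add DERIV_ident)
    moreover have "1 + Im (?x / W t - \<i>) > 0" using Im_pos[of t] by simp
    ultimately show ?thesis by blast
  qed
  have mono: "\<tau> s \<le> \<tau> t" if "s \<le> t" for s t
    by (rule DERIV_nonneg_imp_nondecreasing[OF that]) (meson d\<tau> less_imp_le)
  have zper: "z (t + 2 * pi) = z t" for t by (simp add: z_def complex_eq_iff)
  \<comment> \<open>\<open>v\<close> has period \<open>2 * pi\<close>, so only the summand
    \<open>t\<close> of \<open>\<tau>\<close> grows: the tangent makes exactly one turn.\<close>
  have per: "\<tau> (t + 2 * pi) = \<tau> t + 2 * pi" for t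
  proof -
    have "cis (- (t + 2 * pi)) = cis (- t)" by (simp add: complex_eq_iff sin_diff cos_diff)
    then show ?thesis unfolding \<tau>_def v_def zper by simp
  qed
  have W\<tau>: "W t = of_real (r * cmod (v t)) * (\<i> * cis (\<tau> t))" for t
  proof -
    have "v t = exp (Ln (v t))" using vn by simp
    also have "\<dots> = of_real (cmod (v t)) * cis (Im (Ln (v t)))"
      using vn by (simp add: exp_eq_polar)
    finally have "v t = of_real (cmod (v t)) * cis (Im (Ln (v t)))" .
    then have "W t = \<i> * (of_real r * cis t) * (of_real (cmod (v t)) * cis (Im (Ln (v t))))"
      unfolding Wv z_def by (rule arg_cong)
    then show ?thesis unfolding \<tau>_def cis_mult[symmetric] of_real_mult by (simp only: mult_ac)
  qed
  define t0 where "t0 = Arg w"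
  have z0: "z t0 = w" using w r
    by (metis t0_def z_def rcis_cmod_Arg rcis_def)
  \<comment> \<open>Rotation by \<open>n\<close> gives the tangent at \<open>t0\<close> the
    direction \<open>\<i>\<close>, so that the sign of the derivative of \<open>u\<close> is that of
    \<open>- sin (\<tau> t - \<tau> t0)\<close>.\<close>
  define n where "n = cis (- \<tau> t0)"
  define u where "u t = Re (n * F (z t))" for t
  have du: "(u has_real_derivative - (r * cmod (v t)) * sin (\<tau> t - \<tau> t0)) (at t)" for t
  proof -
    have "((\<lambda>t. n * F (z t)) has_vector_derivative n * W t) (at t)"
      using dF by (auto intro!: derivative_eq_intros)
    then have "((\<lambda>t. Re (n * F (z t))) has_real_derivative Re (n * W t)) (at t)"
      by (rule has_field_derivative_Re)
    moreover have "Re (n * W t) = - (r * cmod (v t)) * sin (\<tau> t - \<tau> t0)"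
    proof -
      have "n * W t = of_real (r * cmod (v t)) * (\<i> * cis (\<tau> t - \<tau> t0))"
        unfolding n_def W\<tau> diff_conv_add_uminus cis_mult[symmetric] by (simp only: mult_ac)
      then show ?thesis by simp
    qed
    ultimately show ?thesis by (simp add: u_def[abs_def])
  qed
  \<comment> \<open>\<open>u\<close> falls while the tangent turns through the first
    \<open>pi\<close> and then rises, returning to \<open>u t0\<close> at
    \<open>t0 + 2 * pi\<close>. Points of the first phase are compared with the start, the others
    with the end.\<close>
  have main: "u t \<le> u t0" if t: "t0 \<le> t" "t \<le> t0 + 2 * pi" for t
  proof (cases "\<tau> t - \<tau> t0 \<le> pi")
    case True
    show ?thesis
    proof (rule DERIV_nonpos_imp_nonincreasing[OF t(1)])
      fix s assume s: "t0 \<le> s" "s \<le> t"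
      have "0 \<le> sin (\<tau> s - \<tau> t0)"
        using mono[OF s(1)] mono[OF s(2)] True by (intro sin_ge_zero) auto
      then show "\<exists>y. (u has_real_derivative y) (at s) \<and> y \<le> 0"
        using du[of s] r by (intro exI conjI) auto
    qed
  next
    case False
    have "u t \<le> u (t0 + 2 * pi)"
    proof (rule DERIV_nonneg_imp_nondecreasing[OF t(2)])
      fix s assume s: "t \<le> s" "s \<le> t0 + 2 * pi"
      have "0 \<le> sin (\<tau> t0 + 2 * pi - \<tau> s)"
        using mono[OF s(1)] mono[OF s(2)] False per[of t0] by (intro sin_ge_zero) auto
      moreover have "sin (\<tau> t0 + 2 * pi - \<tau> s) = - sin (\<tau> s - \<tau> t0)"
        by (simp add: sin_diff sin_add)
      ultimately show "\<exists>y. (u has_real_derivative y) (at s) \<and> 0 \<le> y"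
        using du[of s] r by (intro exI conjI) (auto simp: mult_nonneg_nonpos)
    qed
    then show ?thesis by (simp add: u_def zper)
  qed
  have "Re (n * F x) \<le> Re (n * F w)" if x: "cmod x = r" for x
  proof -
    have zx: "z (Arg x) = x" using x r by (metis z_def rcis_cmod_Arg rcis_def)
    show ?thesis
    proof (cases "t0 \<le> Arg x")
      case True
      then show ?thesis using main[of "Arg x"] Arg_bounded[of x] Arg_bounded[of w]
        by (simp add: u_def zx z0[unfolded t0_def] t0_def)
    next
      case False
      then show ?thesis using main[of "Arg x + 2 * pi"] Arg_bounded[of x] Arg_bounded[of w]
        by (simp add: u_def zx z0[unfolded t0_def] t0_def zper)
    qed
  qed
  then show ?thesis by (intro exI[of _ n]) (simp add: n_def)
qed

text \<open>A segment leaving the open image \<open>V\<close> meets its frontier at some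
  \<open>F w\<close> with \<open>|w| = r\<close>. The supporting half plane there contains all of
  \<open>V\<close>, because \<open>Re (n * F)\<close> is the real part of the holomorphic
  \<open>n * H + cnj n * G\<close>. Both endpoints lie strictly inside it, hence so does the whole
  segment, a contradiction.\<close>

lemma convex_image_smaller:
  assumes r: "0 < r" "r < R"
  shows "convex (F ` ball 0 r)"
proof -
  define V where "V = F ` ball 0 r"
  have oV: "open V" unfolding V_def using open_image r by simp
  have cl: "closure V \<subseteq> F ` cball 0 r"
  proof (rule closure_minimal)
    show "V \<subseteq> F ` cball 0 r" by (auto simp: V_def)
    have "cball 0 r \<subseteq> (ball 0 R :: complex set)" using r by auto
    then have "compact (F ` cball 0 r)"
      using cont by (intro compact_continuous_image) (auto intro: continuous_on_subset)
    then show "closed (F ` cball 0 r)" by (rule compact_imp_closed)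
  qed
  show ?thesis unfolding V_def[symmetric] convex_contains_segment
  proof (intro ballI, rule ccontr)
    fix a b assume ab: "a \<in> V" "b \<in> V" "\<not> closed_segment a b \<subseteq> V"
    have "closed_segment a b \<inter> frontier V \<noteq> {}"
      using ab by (intro connected_Int_frontier) auto
    then obtain x where x: "x \<in> closed_segment a b" "x \<in> closure V" "x \<notin> V"
      using oV by (auto simp: frontier_def interior_open)
    then obtain w where w: "x = F w" "w \<in> cball 0 r" using cl by blast
    with x have "cmod w = r" by (force simp: V_def)
    then obtain n where n: "n \<noteq> 0" "\<And>z. cmod z = r \<Longrightarrow> Re (n * F z) \<le> Re (n * F w)"
      using supporting_half_plane[OF r] by blast
    have Re_eq: "Re (n * F z) = Re (n * H z + cnj n * G z)" for z
      by (simp add: F_def algebra_simps)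
    have "Re (n * F z) \<le> Re (n * F w)" if "cmod z \<le> r" for z
      unfolding Re_eq
    proof (rule Re_le_of_sphere[OF _ r _ that])
      show "(\<lambda>z. n * H z + cnj n * G z) holomorphic_on ball 0 R"
        by (intro holomorphic_intros hol)
    qed (use n(2) in \<open>simp only: Re_eq\<close>)
    then have "V \<subseteq> {y. Re (n * y) \<le> Re (n * x)}" by (auto simp: V_def w)
    then have lt: "Re (n * a) < Re (n * x)" "Re (n * b) < Re (n * x)"
      using Re_less_of_open_subset oV ab n by blast+
    obtain u where u: "0 \<le> u" "u \<le> 1" "x = (1 - u) *\<^sub>R a + u *\<^sub>R b"
      using x(1) by (auto simp: closed_segment_def)
    have "Re (n * x) = (1 - u) * Re (n * a) + u * Re (n * b)"
      unfolding u(3) by (simp add: algebra_simps)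
    also have "\<dots> < Re (n * x)"
      using convex_bound_lt[OF lt, of "1 - u" u] u by simp
    finally show False by simp
  qed
qed

lemma convex_image: "convex (F ` ball 0 R)"
  unfolding convex_alt
proof (intro ballI allI impI)
  fix a b and u :: real assume ab: "a \<in> F ` ball 0 R" "b \<in> F ` ball 0 R" and u: "0 \<le> u \<and> u \<le> 1"
  then obtain x y where xy: "a = F x" "b = F y" "cmod x < R" "cmod y < R" by auto
  obtain r where r: "max (cmod x) (cmod y) < r" "r < R" using xy dense by (metis max_less_iff_conj)
  then have "0 < r" using norm_ge_zero[of x] by linarith
  have "a \<in> F ` ball 0 r" "b \<in> F ` ball 0 r" using xy r by auto
  then have "(1 - u) *\<^sub>R a + u *\<^sub>R b \<in> F ` ball 0 r"
    using convex_image_smaller[OF \<open>0 < r\<close> r(2)] u by (auto simp: convex_alt)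
  then show "(1 - u) *\<^sub>R a + u *\<^sub>R b \<in> F ` ball 0 R" using r by fastforce
qed

lemma convex_in_disk: "convex_in_disk (\<lambda>z. H z + cnj (G z)) R"
  using inj convex_image unfolding convex_in_disk_def F_def[abs_def] by blast

end

subsection \<open>Taylor coefficients of dominated functions\<close>

lemma taylor_coef_fps: "taylor_coef f n = fps_nth (fps_expansion f 0) n"
  by (simp add: taylor_coef_def fps_expansion_def)

lemma taylor_coef_0 [simp]: "taylor_coef f 0 = f 0"
  by (simp add: taylor_coef_def)

lemma has_fps_expansion_ball:
  assumes "f holomorphic_on ball 0 1" shows "f has_fps_expansion fps_expansion f 0"
  using assms by (intro has_fps_expansion_fps_expansion[of "ball 0 1"]) auto

lemma fps_nth_eq_taylor_coef: "f has_fps_expansion A \<Longrightarrow> fps_nth A n = taylor_coef f n"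
  by (simp add: taylor_coef_def fps_nth_fps_expansion)

lemma taylor_coef_mult:
  assumes "f holomorphic_on ball 0 1" "g holomorphic_on ball 0 1"
  shows "taylor_coef (\<lambda>z. f z * g z) n = (\<Sum>i\<le>n. taylor_coef f i * taylor_coef g (n - i))"
  using fps_nth_eq_taylor_coef[OF has_fps_expansion_mult[OF has_fps_expansion_ball[OF assms(1)] has_fps_expansion_ball[OF assms(2)]], where n = n]
  by (simp add: fps_mult_nth taylor_coef_fps atLeast0AtMost)

lemma taylor_coef_add:
  assumes "f holomorphic_on ball 0 1" "g holomorphic_on ball 0 1"
  shows "taylor_coef (\<lambda>z. f z + g z) n = taylor_coef f n + taylor_coef g n"
  using fps_nth_eq_taylor_coef[OF has_fps_expansion_add[OF has_fps_expansion_ball[OF assms(1)] has_fps_expansion_ball[OF assms(2)]], where n = n]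
  by (simp add: taylor_coef_fps)

lemma taylor_coef_diff:
  assumes "f holomorphic_on ball 0 1" "g holomorphic_on ball 0 1"
  shows "taylor_coef (\<lambda>z. f z - g z) n = taylor_coef f n - taylor_coef g n"
  using fps_nth_eq_taylor_coef[OF has_fps_expansion_diff[OF has_fps_expansion_ball[OF assms(1)] has_fps_expansion_ball[OF assms(2)]], where n = n]
  by (simp add: taylor_coef_fps)

lemma taylor_coef_cmult:
  assumes "f holomorphic_on ball 0 1"
  shows "taylor_coef (\<lambda>z. c * f z) n = c * taylor_coef f n"
  using fps_nth_eq_taylor_coef[OF has_fps_expansion_cmult_left[OF has_fps_expansion_ball[OF assms]], where n = n]
  by (simp add: taylor_coef_fps)

lemma taylor_coef_const: "taylor_coef (\<lambda>z. c) n = (if n = 0 then c else 0)"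
  using fps_nth_eq_taylor_coef[OF has_fps_expansion_const, of c n] by simp

lemma taylor_coef_ident: "taylor_coef (\<lambda>z. z) n = (if n = 1 then 1 else 0)"
  using fps_nth_eq_taylor_coef[OF has_fps_expansion_fps_X, of n] by simp

lemma taylor_coef_cong:
  assumes "\<And>z. z \<in> ball 0 1 \<Longrightarrow> f z = g z"
  shows "taylor_coef f n = taylor_coef g n"
proof -
  have "(deriv ^^ n) f 0 = (deriv ^^ n) g 0"
    using assms by (intro higher_deriv_cong_ev) (auto simp: eventually_nhds intro!: exI[of _ "ball 0 1"])
  then show ?thesis by (simp add: taylor_coef_def)
qed

lemma taylor_coef_deriv: "taylor_coef (deriv f) n = of_nat (Suc n) * taylor_coef f (Suc n)"
  unfolding taylor_coef_def fact_Suc of_nat_mult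
  by (simp add: funpow_swap1 del: of_nat_Suc fact_Suc)

section \<open>Means over circles and coefficient bounds\<close>

lemma circle_integral_div_power:
  assumes f: "f holomorphic_on ball 0 1" and R: "0 < R" "R < 1"
  shows "((\<lambda>t. f (circlepath 0 R t) / circlepath 0 R t ^ n) has_integral taylor_coef f n) {0..1}"
proof -
  have "continuous_on (cball 0 R) f" "f holomorphic_on ball 0 R"
    using f R by (auto intro!: holomorphic_on_imp_continuous_on elim: holomorphic_on_subset)
  from Cauchy_has_contour_integral_higher_derivative_circlepath[OF this, of 0 n]
  have "((\<lambda>u. f u / u ^ Suc n) has_contour_integral 2 * pi * \<i> * taylor_coef f n) (circlepath 0 R)"
    using R by (simp add: taylor_coef_def)
  then have "((\<lambda>t. f (circlepath 0 R t) / circlepath 0 R t ^ Suc n * vector_derivative (circlepath 0 R) (at t within {0..1}))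
      has_integral 2 * pi * \<i> * taylor_coef f n) {0..1}"
    by (simp add: has_contour_integral_def)
  then have "((\<lambda>t. 1 / (2 * pi * \<i>) * (f (circlepath 0 R t) / circlepath 0 R t ^ Suc n * vector_derivative (circlepath 0 R) (at t within {0..1})))
      has_integral 1 / (2 * pi * \<i>) * (2 * pi * \<i> * taylor_coef f n)) {0..1}"
    by (rule has_integral_mult_right)
  then show ?thesis
  proof (rule has_integral_eq_rhs[OF has_integral_eq[rotated]])
    fix t :: real assume t: "t \<in> {0..1}"
    have "circlepath 0 R t = of_real R * exp (2 * of_real pi * \<i> * of_real t)"
      by (simp add: circlepath)
    \<comment> \<open>On the circle \<open>dz = 2 * pi * \<i> * z dt\<close>, which cancels the
      constant in Cauchy's formula and one power of \<open>z\<close>.\<close>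
    then have "vector_derivative (circlepath 0 R) (at t within {0..1}) = 2 * pi * \<i> * circlepath 0 R t" "circlepath 0 R t \<noteq> 0"
      using t R by (auto simp: vector_derivative_circlepath01)
    then show "1 / (2 * pi * \<i>) * (f (circlepath 0 R t) / circlepath 0 R t ^ Suc n * vector_derivative (circlepath 0 R) (at t within {0..1}))
        = f (circlepath 0 R t) / circlepath 0 R t ^ n"
      by simp
  qed simp
qed

lemma circle_integral_mult_power:
  assumes f: "f holomorphic_on ball 0 1" and R: "0 < R" "R < 1" and "n > 0"
  shows "((\<lambda>t. f (circlepath 0 R t) * circlepath 0 R t ^ n) has_integral 0) {0..1}"
proof -
  have "(\<lambda>z. f z * z ^ n) holomorphic_on ball 0 1" by (intro holomorphic_intros f)
  from circle_integral_div_power[OF this R, of 0] show ?thesis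
    using \<open>n > 0\<close> by (simp add: power_0_left)
qed

lemma norm_circlepath: "R > 0 \<Longrightarrow> cmod (circlepath 0 R t) = R"
  by (simp add: circlepath norm_mult)

text \<open>Used to let the radius tend to \<open>1\<close> in estimates proved on smaller
  circles.\<close>

lemma le_of_le_radius:
  fixes p :: "real \<Rightarrow> real"
  assumes "isCont p 1" "\<And>R. \<lbrakk>0 < R; R < 1\<rbrakk> \<Longrightarrow> p R \<le> c"
  shows "p 1 \<le> c"
proof (rule tendsto_upperbound)
  show "(p \<longlongrightarrow> p 1) (at_left 1)"
    using assms(1) by (simp add: continuous_within isCont_def filterlim_at_split)
  show "\<forall>\<^sub>F R in at_left 1. p R \<le> c"
    by (rule eventually_at_leftI[of 0]) (use assms(2) in auto)
qed simp

text \<open>The factor \<open>e\<close> rotates the coefficient onto the nonnegative real axis, so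
  that pointwise inequalities between real parts integrate to a bound on its modulus.\<close>

lemma norm_taylor_coef_power_has_integral:
  assumes f: "f holomorphic_on ball 0 1" and R: "0 < R" "R < 1"
  obtains e where "((\<lambda>t. Re (e * f (circlepath 0 R t) / circlepath 0 R t ^ n)) has_integral cmod (taylor_coef f n)) {0..1}"
    "cmod e = 1"
proof -
  obtain e where e: "e * taylor_coef f n = of_real (cmod (taylor_coef f n))" "cmod e = 1"
  proof (cases "taylor_coef f n = 0")
    case False
    then show ?thesis using that[of "of_real (cmod (taylor_coef f n)) / taylor_coef f n"] by (simp add: norm_divide)
  qed (use that[of 1] in auto)
  have "((\<lambda>t. Re (e * (f (circlepath 0 R t) / circlepath 0 R t ^ n))) has_integral Re (e * taylor_coef f n)) {0..1}"
    by (intro has_integral_Re has_integral_mult_right circle_integral_div_power assms)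
  then show ?thesis using e by (intro that[of e]) auto
qed

text \<open>A holomorphic majorant's real part has mean value equal to its value at the centre.\<close>

lemma coef_bound_of_Re_majorant:
  assumes f: "f holomorphic_on ball 0 1" and G: "G holomorphic_on ball 0 1"
    and le: "\<And>z. z \<in> ball 0 1 \<Longrightarrow> cmod (f z) \<le> Re (G z)"
  shows "cmod (taylor_coef f n) \<le> Re (G 0)"
proof -
  have "cmod (taylor_coef f n) * R ^ n \<le> Re (G 0)" if R: "0 < R" "R < 1" for R
  proof -
    obtain e where e: "((\<lambda>t. Re (e * f (circlepath 0 R t) / circlepath 0 R t ^ n)) has_integral cmod (taylor_coef f n)) {0..1}" "cmod e = 1"
      using norm_taylor_coef_power_has_integral[OF f R] .
    have "((\<lambda>t. Re (e * f (circlepath 0 R t) / circlepath 0 R t ^ n) * R ^ n) has_integral cmod (taylor_coef f n) * R ^ n) {0..1}"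
      by (rule has_integral_mult_left[OF e(1)])
    moreover have "((\<lambda>t. Re (G (circlepath 0 R t))) has_integral Re (G 0)) {0..1}"
      using has_integral_Re[OF circle_integral_div_power[OF G R, of 0]] by simp
    ultimately show ?thesis
    proof (rule has_integral_le)
      fix t :: real assume "t \<in> {0..1}"
      let ?z = "circlepath 0 R t"
      have "Re (e * f ?z / ?z ^ n) * R ^ n \<le> cmod (e * f ?z / ?z ^ n) * R ^ n"
        using R by (intro mult_right_mono complex_Re_le_cmod) auto
      also have "\<dots> = cmod (f ?z)" using e R by (simp add: norm_mult norm_divide norm_power norm_circlepath)
      also have "\<dots> \<le> Re (G ?z)" using R by (intro le) (simp add: norm_circlepath)
      finally show "Re (e * f ?z / ?z ^ n) * R ^ n \<le> Re (G ?z)" .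
    qed
  qed
  then show ?thesis
    using le_of_le_radius[of "\<lambda>R. cmod (taylor_coef f n) * R ^ n"] by simp
qed

text \<open>A mean that vanishes by \<open>circle_integral_mult_power\<close> is added. With
  \<open>u = e / z ^ n\<close> its integrand on the circle is \<open>Re (cnj u * f)\<close>, and
  \<open>Re (u * f) + Re (cnj u * f) = 2 * Re u * Re f\<close>, which is at most
  \<open>2 * |u| * Re f\<close>.\<close>

lemma Caratheodory_coef_bound:
  assumes f: "f holomorphic_on ball 0 1" and Re_f: "\<And>z. z \<in> ball 0 1 \<Longrightarrow> Re (f z) \<ge> 0" and n: "n > 0"
  shows "cmod (taylor_coef f n) \<le> 2 * Re (f 0)"
proof -
  have "cmod (taylor_coef f n) * R ^ n \<le> 2 * Re (f 0)" if R: "0 < R" "R < 1" for R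
  proof -
    obtain e where e: "((\<lambda>t. Re (e * f (circlepath 0 R t) / circlepath 0 R t ^ n)) has_integral cmod (taylor_coef f n)) {0..1}" "cmod e = 1"
      using norm_taylor_coef_power_has_integral[OF f R] .
    have "((\<lambda>t. cnj e * (f (circlepath 0 R t) * circlepath 0 R t ^ n) / of_real (R ^ (2 * n))) has_integral cnj e * 0 / of_real (R ^ (2 * n))) {0..1}"
      by (intro has_integral_divide has_integral_mult_right circle_integral_mult_power f R n)
    from has_integral_Re[OF this]
    have "((\<lambda>t. Re (cnj e * (f (circlepath 0 R t) * circlepath 0 R t ^ n) / of_real (R ^ (2 * n)))) has_integral 0) {0..1}"
      by (simp only: mult_zero_right div_0 zero_complex.sel)
    from has_integral_mult_left[OF has_integral_add[OF e(1) this], of "R ^ n"]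
    have "((\<lambda>t. (Re (e * f (circlepath 0 R t) / circlepath 0 R t ^ n) + Re (cnj e * (f (circlepath 0 R t) * circlepath 0 R t ^ n) / of_real (R ^ (2 * n)))) * R ^ n)
        has_integral cmod (taylor_coef f n) * R ^ n) {0..1}" by simp
    moreover have "((\<lambda>t. 2 * Re (f (circlepath 0 R t))) has_integral 2 * Re (f 0)) {0..1}"
      using has_integral_mult_right[OF has_integral_Re[OF circle_integral_div_power[OF f R, of 0]], of 2] by simp
    ultimately show ?thesis
    proof (rule has_integral_le)
      fix t :: real assume "t \<in> {0..1}"
      let ?z = "circlepath 0 R t"
      have z: "cmod ?z = R" "?z \<noteq> 0" using R norm_circlepath[of R t] by auto
      define u where "u = e / ?z ^ n"
      have "cnj e * (f ?z * ?z ^ n) / of_real (R ^ (2 * n)) = cnj u * f ?z"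
      proof -
        have "of_real (R ^ (2 * n)) = ?z ^ n * cnj (?z ^ n)"
          by (metis complex_norm_square norm_power z(1) power_mult mult.commute)
        then show ?thesis using z by (simp add: u_def)
      qed
      moreover have "e * f ?z / ?z ^ n = u * f ?z" by (simp add: u_def)
      ultimately have "Re (e * f ?z / ?z ^ n) + Re (cnj e * (f ?z * ?z ^ n) / of_real (R ^ (2 * n))) = 2 * Re u * Re (f ?z)"
        by simp
      also have "\<dots> \<le> 2 * cmod u * Re (f ?z)"
        using Re_f[of ?z] z R by (intro mult_right_mono mult_left_mono complex_Re_le_cmod) auto
      also have "\<dots> * R ^ n = 2 * Re (f ?z)"
        using z e(2) R by (simp add: u_def norm_divide norm_power)
      finally show "(Re (e * f ?z / ?z ^ n) + Re (cnj e * (f ?z * ?z ^ n) / of_real (R ^ (2 * n)))) * R ^ n \<le> 2 * Re (f ?z)"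
        using R by (simp add: mult_right_mono)
    qed
  qed
  then show ?thesis
    using le_of_le_radius[of "\<lambda>R. cmod (taylor_coef f n) * R ^ n"] by simp
qed

text \<open>Integrating \<open>|w|\<^sup>2 \<ge> 2 Re (w cnj l) - |l|\<^sup>2\<close> with \<open>l\<close> the quadratic Taylor part of \<open>w\<close> replaces
  Parseval's identity.\<close>

lemma coef_bound_of_square_majorant:
  assumes f: "f holomorphic_on ball 0 1" and w: "w holomorphic_on ball 0 1"
    and le: "\<And>z. z \<in> ball 0 1 \<Longrightarrow> cmod (f z) \<le> 1 - (cmod (w z))\<^sup>2"
  shows "cmod (taylor_coef f n) \<le> 1 - (cmod (taylor_coef w 1))\<^sup>2 - (cmod (taylor_coef w 2))\<^sup>2"
proof -
  define a b where "a = taylor_coef w 1" and "b = taylor_coef w 2"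
  have "cmod (taylor_coef f n) * R ^ n + (cmod a)\<^sup>2 * R\<^sup>2 + (cmod b)\<^sup>2 * R ^ 4 \<le> 1" if R: "0 < R" "R < 1" for R
  proof -
    define l where "l z = a * z + b * z\<^sup>2" for z
    \<comment> \<open>On \<open>|z| = R\<close> this is \<open>cnj (l z)\<close>, rewritten in
      powers of \<open>1 / z\<close>, so that the mean of \<open>u * m\<close> reads off Taylor
      coefficients of a holomorphic \<open>u\<close>.\<close>
    define m where "m z = cnj a * of_real (R\<^sup>2) / z + cnj b * of_real (R ^ 4) / z\<^sup>2" for z
    have ml: "m z = cnj (l z)" if "cmod z = R" for z
    proof -
      have "of_real (R\<^sup>2) = z * cnj z" using that by (metis complex_norm_square)
      moreover from this have "of_real (R ^ 4) = (z * cnj z)\<^sup>2"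
        by (metis of_real_power power_mult numeral_Bit0 mult_2)
      moreover have "z \<noteq> 0" using that R by auto
      ultimately show ?thesis by (simp add: m_def l_def power2_eq_square)
    qed
    have mean: "((\<lambda>t. u (circlepath 0 R t) * m (circlepath 0 R t)) has_integral
        cnj a * of_real (R\<^sup>2) * taylor_coef u 1 + cnj b * of_real (R ^ 4) * taylor_coef u 2) {0..1}"
      if u: "u holomorphic_on ball 0 1" for u
    proof -
      have "((\<lambda>t. cnj a * of_real (R\<^sup>2) * (u (circlepath 0 R t) / circlepath 0 R t ^ 1) + cnj b * of_real (R ^ 4) * (u (circlepath 0 R t) / circlepath 0 R t ^ 2))
          has_integral cnj a * of_real (R\<^sup>2) * taylor_coef u 1 + cnj b * of_real (R ^ 4) * taylor_coef u 2) {0..1}"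
        by (intro has_integral_add has_integral_mult_right circle_integral_div_power u R)
      then show ?thesis by (simp add: m_def algebra_simps)
    qed
    have lh: "l holomorphic_on ball 0 1" unfolding l_def[abs_def] by (intro holomorphic_intros)
    have lE: "l has_fps_expansion fps_const a * fps_X + fps_const b * fps_X ^ 2"
      unfolding l_def[abs_def] by (intro fps_expansion_intros)
    have lc: "taylor_coef l 1 = a" "taylor_coef l 2 = b"
      by (simp_all flip: fps_nth_eq_taylor_coef[OF lE])
    define K where "K = (cmod a)\<^sup>2 * R\<^sup>2 + (cmod b)\<^sup>2 * R ^ 4"
    have Keq: "cnj a * of_real (R\<^sup>2) * a + cnj b * of_real (R ^ 4) * b = of_real K"
      unfolding K_def of_real_add of_real_mult complex_norm_square by (simp add: algebra_simps)
    have i1: "((\<lambda>t. Re (w (circlepath 0 R t) * m (circlepath 0 R t))) has_integral K) {0..1}"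
      using has_integral_Re[OF mean[OF w]] by (simp only: a_def[symmetric] b_def[symmetric] Keq Re_complex_of_real)
    have i2: "((\<lambda>t. Re (l (circlepath 0 R t) * m (circlepath 0 R t))) has_integral K) {0..1}"
      using has_integral_Re[OF mean[OF lh]] by (simp only: lc Keq Re_complex_of_real)
    obtain e where e: "((\<lambda>t. Re (e * f (circlepath 0 R t) / circlepath 0 R t ^ n)) has_integral cmod (taylor_coef f n)) {0..1}" "cmod e = 1"
      using norm_taylor_coef_power_has_integral[OF f R] .
    have "((\<lambda>t. Re (e * f (circlepath 0 R t) / circlepath 0 R t ^ n) * R ^ n) has_integral cmod (taylor_coef f n) * R ^ n) {0..1}"
      by (rule has_integral_mult_left[OF e(1)])
    moreover have "((\<lambda>t. 1 - 2 * Re (w (circlepath 0 R t) * m (circlepath 0 R t)) + Re (l (circlepath 0 R t) * m (circlepath 0 R t)))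
       has_integral 1 - 2 * K + K) {0..1}"
      using has_integral_const_real[of "1::real" 0 1]
      by (intro has_integral_add has_integral_diff has_integral_mult_right i1 i2) simp
    ultimately have "cmod (taylor_coef f n) * R ^ n \<le> 1 - 2 * K + K"
    proof (rule has_integral_le)
      fix t :: real assume "t \<in> {0..1}"
      let ?z = "circlepath 0 R t"
      have z: "cmod ?z = R" using R by (simp add: norm_circlepath)
      have "Re (e * f ?z / ?z ^ n) * R ^ n \<le> cmod (e * f ?z / ?z ^ n) * R ^ n"
        using R by (intro mult_right_mono complex_Re_le_cmod) auto
      also have "\<dots> = cmod (f ?z)" using e R by (simp add: norm_mult norm_divide norm_power norm_circlepath)
      also have "\<dots> \<le> 1 - (cmod (w ?z))\<^sup>2" using R z by (intro le) simp
      also have "\<dots> \<le> 1 - 2 * Re (w ?z * m ?z) + Re (l ?z * m ?z)"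
      proof -
        have "0 \<le> (cmod (w ?z - l ?z))\<^sup>2" by simp
        also have "\<dots> = (cmod (w ?z))\<^sup>2 - 2 * Re (w ?z * cnj (l ?z)) + Re (l ?z * cnj (l ?z))"
          unfolding cmod_power2 by (simp add: algebra_simps power2_eq_square)
        finally show ?thesis by (simp add: ml[OF z])
      qed
      finally show "Re (e * f ?z / ?z ^ n) * R ^ n \<le> 1 - 2 * Re (w ?z * m ?z) + Re (l ?z * m ?z)" .
    qed
    then have "cmod (taylor_coef f n) * R ^ n \<le> 1 - K" by simp
    then show ?thesis by (simp only: K_def le_diff_eq add.assoc)
  qed
  then have "cmod (taylor_coef f n) * 1 ^ n + (cmod a)\<^sup>2 * 1\<^sup>2 + (cmod b)\<^sup>2 * 1 ^ 4 \<le> 1"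
    by (intro le_of_le_radius[of "\<lambda>R. cmod (taylor_coef f n) * R ^ n + (cmod a)\<^sup>2 * R\<^sup>2 + (cmod b)\<^sup>2 * R ^ 4"]) auto
  then show ?thesis by (simp add: a_def b_def)
qed

subsection \<open>Coefficient relations in the class\<close>

text \<open>Turns a sum of two moduli into the modulus of one combination, to which a bound for a
  single function applies.\<close>

lemma ex_unimodular_aligned: "\<exists>e. cmod e = 1 \<and> cmod (e * a + b) = cmod a + cmod b"
proof (intro exI conjI)
  let ?e = "cis (Arg b - Arg a)"
  show "cmod ?e = 1" by simp
  have "?e * a = rcis (cmod a) (Arg b)"
    by (subst (2) rcis_cmod_Arg[symmetric]) (simp add: rcis_def cis_mult)
  moreover have "b = rcis (cmod b) (Arg b)" by (simp add: rcis_cmod_Arg)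
  ultimately have "?e * a + b = of_real (cmod a + cmod b) * cis (Arg b)"
    by (metis distrib_right of_real_add rcis_def)
  then show "cmod (?e * a + b) = cmod a + cmod b" by (simp add: norm_mult del: of_real_add)
qed

text \<open>If \<open>\<phi> r = Re (f (r z)) - \<beta>\<close>, the hypothesis says that \<open>r powr (1/\<alpha>) * \<phi> r\<close> increases; it
  vanishes at \<open>0\<close>.\<close>

lemma Re_gt_of_Re_add_deriv_gt:
  assumes f: "f holomorphic_on ball 0 1" and \<alpha>: "\<alpha> \<ge> 0"
    and gt: "\<And>z. z \<in> ball 0 1 \<Longrightarrow> \<beta> < Re (f z + of_real \<alpha> * z * deriv f z)"
    and z: "z \<in> ball 0 1"
  shows "\<beta> < Re (f z)"
proof (cases "\<alpha> = 0")
  case True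
  then show ?thesis using gt[OF z] by simp
next
  case False
  then have \<alpha>: "\<alpha> > 0" using \<alpha> by simp
  define \<phi> where "\<phi> r = Re (f (of_real r * z)) - \<beta>" for r
  define \<psi> where "\<psi> r = r powr (1 / \<alpha>) * \<phi> r" for r
  have mem: "of_real r * z \<in> ball 0 1" if "0 \<le> r" "r \<le> 1" for r :: real
  proof -
    have "r * cmod z \<le> 1 * cmod z" using that by (intro mult_right_mono) auto
    then show ?thesis using z that by (simp add: norm_mult)
  qed
  have d\<phi>: "(\<phi> has_real_derivative Re (z * deriv f (of_real r * z))) (at r)" if "0 \<le> r" "r \<le> 1" for r
  proof -
    have "((\<lambda>r. of_real r * z) has_vector_derivative z) (at r)"
      by (auto intro!: derivative_eq_intros)
    moreover have "(f has_field_derivative deriv f (of_real r * z)) (at (of_real r * z))"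
      using holomorphic_derivI[OF f open_ball mem[OF that]] .
    ultimately have "((\<lambda>r. f (of_real r * z)) has_vector_derivative z * deriv f (of_real r * z)) (at r)"
      using field_vector_diff_chain_at[of "\<lambda>r. of_real r * z"] unfolding o_def by blast
    then have "((\<lambda>r. Re (f (of_real r * z))) has_real_derivative Re (z * deriv f (of_real r * z))) (at r)"
      by (rule has_field_derivative_Re)
    from DERIV_diff[OF this DERIV_const[of \<beta>]] show ?thesis by (simp add: \<phi>_def[abs_def])
  qed
  have cont: "continuous_on {0..1} \<psi>"
      unfolding \<psi>_def[abs_def]
    proof (rule continuous_on_mult)
      show "continuous_on {0..1} \<phi>"
        using d\<phi> by (intro continuous_at_imp_continuous_on ballI) (meson DERIV_isCont atLeastAtMost_iff)
      show "continuous_on {0..1} (\<lambda>r. r powr (1 / \<alpha>))"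
        using \<alpha> by (intro continuous_on_powr' continuous_on_id continuous_on_const) auto
    qed
  have "\<psi> 0 < \<psi> 1"
  \<comment> \<open>At \<open>0\<close> the power \<open>r powr (1 / \<alpha>)\<close> may fail to
    be differentiable, so derivatives are taken on the open interval and continuity covers the
    ends.\<close>
  proof (rule DERIV_pos_imp_increasing_open[OF _ _ cont])
    fix r :: real assume r: "0 < r" "r < 1"
    have "(\<psi> has_real_derivative 1 / \<alpha> * r powr (1 / \<alpha> - 1) * \<phi> r + Re (z * deriv f (of_real r * z)) * r powr (1 / \<alpha>)) (at r)"
      unfolding \<psi>_def[abs_def] using r
      by (intro DERIV_mult d\<phi> has_real_derivative_powr) auto
    moreover have "1 / \<alpha> * r powr (1 / \<alpha> - 1) * \<phi> r + Re (z * deriv f (of_real r * z)) * r powr (1 / \<alpha>)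
        = 1 / \<alpha> * r powr (1 / \<alpha> - 1) * (\<phi> r + \<alpha> * r * Re (z * deriv f (of_real r * z)))"
    proof -
      have "r powr (1 / \<alpha>) = r powr (1 / \<alpha> - 1) * r"
        using r by (simp add: powr_diff)
      then show ?thesis using \<alpha> by (simp add: field_simps)
    qed
    moreover have "\<phi> r + \<alpha> * r * Re (z * deriv f (of_real r * z)) > 0"
      using gt[OF mem[of r]] r by (simp add: \<phi>_def algebra_simps)
    then have "1 / \<alpha> * r powr (1 / \<alpha> - 1) * (\<phi> r + \<alpha> * r * Re (z * deriv f (of_real r * z))) > 0"
      using \<alpha> r by (intro mult_pos_pos) auto
    ultimately show "\<exists>y. (\<psi> has_real_derivative y) (at r) \<and> y > 0"
      by metis
  qed simp
  then show ?thesis by (simp add: \<psi>_def \<phi>_def)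
qed

text \<open>For the fixed \<open>z\<close>, the factor \<open>e\<close> rotates \<open>g'(z)\<close>
  onto the nonpositive real axis. Then \<open>h' + e * g'\<close> satisfies the hypothesis of
  \<open>Re_gt_of_Re_add_deriv_gt\<close>, whose conclusion at \<open>z\<close> is the
  claim.\<close>

lemma W_H0_deriv_bound:
  assumes W: "W_H0 \<alpha> \<beta> h g" and \<alpha>: "\<alpha> \<ge> 0" and z: "z \<in> ball 0 1"
  shows "cmod (deriv g z) < Re (deriv h z) - \<beta>"
proof -
  have hol: "h holomorphic_on ball 0 1" "g holomorphic_on ball 0 1"
    using W by (auto simp: W_H0_def harmonic_H0_def)
  have hol': "deriv h holomorphic_on ball 0 1" "deriv g holomorphic_on ball 0 1"
    using hol by (auto intro: holomorphic_deriv)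
  obtain e where e: "cmod e = 1" "Re (e * deriv g z) = - cmod (deriv g z)"
  proof (cases "deriv g z = 0")
    case False
    then show ?thesis
      using that[of "- of_real (cmod (deriv g z)) / deriv g z"] by (simp add: norm_divide)
  qed (use that[of 1] in auto)
  have "\<beta> < Re (deriv h z + e * deriv g z)"
  proof (rule Re_gt_of_Re_add_deriv_gt[OF _ \<alpha> _ z])
    show "(\<lambda>z. deriv h z + e * deriv g z) holomorphic_on ball 0 1"
      by (intro holomorphic_intros hol')
    fix x :: complex assume x: "x \<in> ball 0 1"
    have "deriv (\<lambda>z. deriv h z + e * deriv g z) x = deriv (deriv h) x + e * deriv (deriv g) x"
      by (intro DERIV_imp_deriv DERIV_add DERIV_cmult holomorphic_derivI[OF hol'(1) open_ball x]
          holomorphic_derivI[OF hol'(2) open_ball x])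
    moreover have "- cmod (deriv g x + of_real \<alpha> * x * deriv (deriv g) x)
        \<le> Re (e * (deriv g x + of_real \<alpha> * x * deriv (deriv g) x))"
      using abs_Re_le_cmod[of "e * (deriv g x + of_real \<alpha> * x * deriv (deriv g) x)"] e(1)
      by (simp only: norm_mult)
    moreover have "cmod (deriv g x + of_real \<alpha> * x * deriv (deriv g) x)
        < Re (deriv h x + of_real \<alpha> * x * deriv (deriv h) x - of_real \<beta>)"
      using W x by (simp only: W_H0_def)
    ultimately show "\<beta> < Re (deriv h x + e * deriv g x + of_real \<alpha> * x * deriv (\<lambda>z. deriv h z + e * deriv g z) x)"
      by (simp add: algebra_simps)
  qed
  then show ?thesis using e by simp
qed

section \<open>Coefficients of a function dominated by a real part\<close>

locale dominated_pair =
  fixes P q :: "complex \<Rightarrow> complex" and \<beta> :: real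
  assumes P_hol: "P holomorphic_on ball 0 1" and q_hol: "q holomorphic_on ball 0 1"
    and P_0: "P 0 = 1" and q_0: "q 0 = 0"
    and dominated: "\<And>z. z \<in> ball 0 1 \<Longrightarrow> cmod (q z) \<le> Re (P z) - \<beta>"
begin

lemma q_coef_bound: "cmod (taylor_coef q n) \<le> 1 - \<beta>"
proof -
  have "(\<lambda>z. P z - of_real \<beta>) holomorphic_on ball 0 1" by (intro holomorphic_intros P_hol)
  from coef_bound_of_Re_majorant[OF q_hol this, of n] show ?thesis using dominated P_0 by simp
qed

text \<open>After alignment by \<open>e\<close> the sum is the modulus of a coefficient of
  \<open>e * q + (P - \<beta>)\<close>, which has nonnegative real part and value
  \<open>1 - \<beta>\<close> at \<open>0\<close>.\<close>

lemma sum_coef_bound: "n > 0 \<Longrightarrow> cmod (taylor_coef P n) + cmod (taylor_coef q n) \<le> 2 * (1 - \<beta>)"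
proof -
  assume n: "n > 0"
  obtain e where e: "cmod e = 1" "cmod (e * taylor_coef q n + taylor_coef P n) = cmod (taylor_coef q n) + cmod (taylor_coef P n)"
    using ex_unimodular_aligned by blast
  have eq: "(\<lambda>z. e * q z) holomorphic_on ball 0 1" "(\<lambda>z. P z - of_real \<beta>) holomorphic_on ball 0 1"
    by (intro holomorphic_intros P_hol q_hol)+
  have "cmod (taylor_coef (\<lambda>z. e * q z + (P z - of_real \<beta>)) n) \<le> 2 * Re (e * q 0 + (P 0 - of_real \<beta>))"
  proof (rule Caratheodory_coef_bound[OF _ _ n])
    show "(\<lambda>z. e * q z + (P z - of_real \<beta>)) holomorphic_on ball 0 1"
      by (intro holomorphic_intros P_hol q_hol)
    fix z :: complex assume z: "z \<in> ball 0 1"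
    have "- cmod (q z) \<le> Re (e * q z)"
      using abs_Re_le_cmod[of "e * q z"] e(1) by (simp only: norm_mult)
    then show "0 \<le> Re (e * q z + (P z - of_real \<beta>))" using dominated[OF z] by simp
  qed
  moreover have "taylor_coef (\<lambda>z. e * q z + (P z - of_real \<beta>)) n = e * taylor_coef q n + taylor_coef P n"
    using n by (simp add: taylor_coef_add[OF eq] taylor_coef_diff P_hol taylor_coef_cmult q_hol taylor_coef_const)
  ultimately show ?thesis using e P_0 q_0 by simp
qed

end

lemma taylor_coef_affine: "taylor_coef (\<lambda>z. a + b * z) n = (if n = 0 then a else if n = 1 then b else 0)"
  by (simp add: taylor_coef_add taylor_coef_cmult taylor_coef_const taylor_coef_ident holomorphic_intros)

lemma norm_Blaschke_le:
  assumes "cmod z < 1" "cmod c < 1"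
  shows "cmod ((z + c) / (1 + cnj c * z)) \<le> 1" "1 + cnj c * z \<noteq> 0"
proof -
  have eq: "(cmod (1 + cnj c * z))\<^sup>2 = (cmod (z + c))\<^sup>2 + (1 - (cmod z)\<^sup>2) * (1 - (cmod c)\<^sup>2)"
    unfolding cmod_power2 by (simp add: algebra_simps power2_eq_square)
  moreover have pos: "(1 - (cmod z)\<^sup>2) * (1 - (cmod c)\<^sup>2) > 0"
    using assms by (simp add: power_less_one_iff abs_square_less_1)
  ultimately have "(cmod (z + c))\<^sup>2 \<le> (cmod (1 + cnj c * z))\<^sup>2" by simp
  then have "cmod (z + c) \<le> cmod (1 + cnj c * z)" by (rule power2_le_imp_le) simp
  moreover show "1 + cnj c * z \<noteq> 0"
    using eq pos by (metis add_nonneg_pos less_irrefl norm_zero zero_le_power2 zero_power2)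
  ultimately show "cmod ((z + c) / (1 + cnj c * z)) \<le> 1" by (simp add: norm_divide)
qed

text \<open>With \<open>w = (P - 1) / (P + 1)\<close> the domination becomes \<open>|q (1 - w)\<^sup>2| \<le> 1 - |w|\<^sup>2\<close>; a Blaschke factor
  then gives the relation between the first two coefficients of \<open>q\<close>.\<close>

lemma (in dominated_pair) second_order_coefs:
  assumes \<beta>: "\<beta> = 0"
  obtains a b where "taylor_coef P 1 = 2 * a" "taylor_coef P 2 = 2 * b + 2 * a\<^sup>2"
    "cmod (taylor_coef q 1) \<le> 1 - (cmod a)\<^sup>2 - (cmod b)\<^sup>2"
    "\<And>t. \<lbrakk>0 \<le> t; t < 1\<rbrakk> \<Longrightarrow> t * cmod (taylor_coef q 2)
       \<le> 1 - (cmod a)\<^sup>2 - (1 - t\<^sup>2) * cmod (taylor_coef q 1) + 2 * t * cmod a * cmod (taylor_coef q 1)"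
proof -
  define w where "w z = (P z - 1) / (P z + 1)" for z
  define s where "s z = 1 - w z" for z
  define qh where "qh z = q z * (s z * s z)" for z
  have P1: "P z + 1 \<noteq> 0" if "z \<in> ball 0 1" for z
  proof -
    have "Re (P z + 1) > 0" using dominated[OF that] norm_ge_zero[of "q z"] \<beta>
      unfolding plus_complex.sel one_complex.sel by linarith
    then show ?thesis by (metis less_irrefl zero_complex.sel(1))
  qed
  have w: "w holomorphic_on ball 0 1" unfolding w_def[abs_def] using P1 by (intro holomorphic_intros P_hol) auto
  have s: "s holomorphic_on ball 0 1" unfolding s_def[abs_def] by (intro holomorphic_intros w)
  have ss: "(\<lambda>z. s z * s z) holomorphic_on ball 0 1" by (intro holomorphic_intros s)
  have qh: "qh holomorphic_on ball 0 1" unfolding qh_def[abs_def] by (intro holomorphic_intros s q_hol)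
  have w0: "w 0 = 0" by (simp add: w_def P_0)
  define a b where "a = taylor_coef w 1" and "b = taylor_coef w 2"
  have s_coef: "taylor_coef s 0 = 1" "taylor_coef s 1 = - a" "taylor_coef s 2 = - b"
    using taylor_coef_diff[OF holomorphic_on_const[of 1] w]
    by (auto simp: s_def[abs_def] taylor_coef_const a_def b_def w0)
  \<comment> \<open>As \<open>P = (1 + w) / (1 - w)\<close>, comparing coefficients in
    \<open>P * s = 1 + w\<close> yields those of \<open>P\<close> from those of
    \<open>w\<close>.\<close>
  have "taylor_coef (\<lambda>z. P z * s z) n = taylor_coef (\<lambda>z. 1 + w z) n" for n
    by (rule taylor_coef_cong) (use P1 in \<open>simp add: s_def w_def field_simps\<close>)
  then have Ps: "(\<Sum>i\<le>n. taylor_coef P i * taylor_coef s (n - i)) = taylor_coef (\<lambda>z. 1) n + taylor_coef w n" for n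
    using taylor_coef_mult[OF P_hol s] taylor_coef_add[OF holomorphic_on_const[of 1] w] by simp
  have p1: "taylor_coef P 1 = 2 * a"
    using Ps[of 1] s_coef P_0 by (simp add: taylor_coef_const a_def algebra_simps)
  have p2: "taylor_coef P 2 = 2 * b + 2 * a\<^sup>2"
    using Ps[of 2] s_coef P_0 p1
    by (simp add: taylor_coef_const b_def algebra_simps numeral_2_eq_2 power2_eq_square)
  have ss_coef: "taylor_coef (\<lambda>z. s z * s z) 0 = 1" "taylor_coef (\<lambda>z. s z * s z) 1 = - 2 * a"
    using s_coef by (simp_all add: taylor_coef_mult[OF s s] algebra_simps del: taylor_coef_0)
  have qh_coef: "taylor_coef qh 0 = 0" "taylor_coef qh 1 = taylor_coef q 1"
      "taylor_coef qh 2 = taylor_coef q 2 - 2 * a * taylor_coef q 1"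
    using ss_coef q_0 s_coef
    by (simp_all add: qh_def[abs_def] taylor_coef_mult[OF q_hol ss] numeral_2_eq_2 algebra_simps)
  have qh_le: "cmod (qh z) \<le> 1 - (cmod (w z))\<^sup>2" if z: "z \<in> ball 0 1" for z
  proof -
    have "s z = 2 / (P z + 1)" using P1[OF z] by (simp add: s_def w_def field_simps)
    then have "cmod (qh z) = cmod (q z) * 4 / (cmod (P z + 1))\<^sup>2"
      by (simp add: qh_def norm_mult norm_divide power2_eq_square)
    also have "\<dots> \<le> Re (P z) * 4 / (cmod (P z + 1))\<^sup>2"
      using dominated[OF z] \<beta> by (intro divide_right_mono mult_right_mono) auto
    also have "Re (P z) * 4 = (cmod (P z + 1))\<^sup>2 - (cmod (P z - 1))\<^sup>2"
      unfolding cmod_power2 by (simp add: algebra_simps power2_eq_square)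
    also have "\<dots> / (cmod (P z + 1))\<^sup>2 = 1 - (cmod (w z))\<^sup>2"
      using P1[OF z] unfolding w_def norm_divide power_divide by (simp add: diff_divide_distrib)
    finally show ?thesis .
  qed
  show ?thesis
  proof (rule that[of a b, OF p1 p2])
    show "cmod (taylor_coef q 1) \<le> 1 - (cmod a)\<^sup>2 - (cmod b)\<^sup>2"
      using coef_bound_of_square_majorant[OF qh w qh_le, of 1] qh_coef by (simp add: a_def b_def)
    fix t :: real assume t: "0 \<le> t" "t < 1"
    obtain e where e: "cmod e = 1" "cmod (e * (of_real t * taylor_coef qh 2) + of_real (1 - t\<^sup>2) * taylor_coef q 1)
        = cmod (of_real t * taylor_coef qh 2) + cmod (of_real (1 - t\<^sup>2) * taylor_coef q 1)"
      using ex_unimodular_aligned by blast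
    \<comment> \<open>The Blaschke factor \<open>(z + c) / (1 + cnj c * z)\<close> starts with
      \<open>c + (1 - |c|\<^sup>2) z\<close>. Multiplying by it keeps the majorant and mixes the
      first two coefficients of \<open>qh\<close> into coefficient \<open>2\<close> of
      \<open>N\<close>; the phase \<open>e\<close> makes their moduli add up.\<close>
    define c where "c = e * of_real t"
    have c: "cmod c < 1" using e(1) t by (simp add: c_def norm_mult)
    have cc: "cnj c * c = of_real (t\<^sup>2)"
      using complex_norm_square[of e] e(1) by (simp add: c_def power2_eq_square mult_ac)
    define N where "N z = qh z * ((z + c) / (1 + cnj c * z))" for z
    have N: "N holomorphic_on ball 0 1"
      unfolding N_def[abs_def] using norm_Blaschke_le(2)[OF _ c] by (intro holomorphic_intros qh) auto
    have "cmod (N z) \<le> 1 - (cmod (w z))\<^sup>2" if z: "z \<in> ball 0 1" for z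
    proof -
      have "cmod (N z) \<le> cmod (qh z) * 1"
        unfolding N_def norm_mult using norm_Blaschke_le(1)[OF _ c, of z] z by (intro mult_left_mono) auto
      then show ?thesis using qh_le[OF z] by simp
    qed
    from coef_bound_of_square_majorant[OF N w this, of 2]
    have "cmod (taylor_coef N 2) \<le> 1 - (cmod a)\<^sup>2" unfolding a_def b_def by (smt (verit) zero_le_power2)
    moreover have "taylor_coef N 2 = c * taylor_coef qh 2 + of_real (1 - t\<^sup>2) * taylor_coef q 1"
    proof -
      define u v where "u z = 1 + cnj c * z" and "v z = c + 1 * z" for z
      have uv: "u holomorphic_on ball 0 1" "v holomorphic_on ball 0 1"
        unfolding u_def[abs_def] v_def[abs_def] by (intro holomorphic_intros)+
      have u: "taylor_coef u 0 = 1" "taylor_coef u 1 = cnj c" "taylor_coef u 2 = 0"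
        and v: "taylor_coef v 0 = c" "taylor_coef v 1 = 1" "taylor_coef v 2 = 0"
        unfolding u_def[abs_def] v_def[abs_def] taylor_coef_affine by simp_all
      have "taylor_coef (\<lambda>z. N z * u z) n = taylor_coef (\<lambda>z. qh z * v z) n" for n
        by (rule taylor_coef_cong)
          (use norm_Blaschke_le(2)[OF _ c] in \<open>simp add: N_def u_def v_def add.commute\<close>)
      then have *: "(\<Sum>i\<le>n. taylor_coef N i * taylor_coef u (n - i)) = (\<Sum>i\<le>n. taylor_coef qh i * taylor_coef v (n - i))" for n
        using taylor_coef_mult[OF N uv(1)] taylor_coef_mult[OF qh uv(2)] by simp
      have N0: "taylor_coef N 0 = 0" using qh_coef(1) by (simp add: N_def)
      then have N1: "taylor_coef N 1 = c * taylor_coef q 1"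
        using *[of 1] qh_coef u v by (simp del: taylor_coef_0)
      have "taylor_coef N 2 + cnj c * taylor_coef N 1 = c * taylor_coef qh 2 + taylor_coef q 1"
        using *[of 2] qh_coef N0 u v by (simp add: numeral_2_eq_2 algebra_simps del: taylor_coef_0)
      from this[unfolded N1] have "taylor_coef N 2 = c * taylor_coef qh 2 + (1 - cnj c * c) * taylor_coef q 1"
        by (simp add: algebra_simps)
      then show ?thesis unfolding cc by simp
    qed
    moreover have "t\<^sup>2 \<le> 1" using t by (simp add: power_le_one)
    ultimately have "t * cmod (taylor_coef qh 2) + (1 - t\<^sup>2) * cmod (taylor_coef q 1) \<le> 1 - (cmod a)\<^sup>2"
      using e(2) t by (simp add: c_def norm_mult mult_ac del: of_real_diff of_real_power)
    moreover have "cmod (taylor_coef q 2) \<le> cmod (taylor_coef qh 2) + 2 * cmod a * cmod (taylor_coef q 1)"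
      using norm_triangle_ineq[of "taylor_coef qh 2" "2 * a * taylor_coef q 1"] qh_coef
      by (simp add: norm_mult)
    then have "t * cmod (taylor_coef q 2) \<le> t * (cmod (taylor_coef qh 2) + 2 * cmod a * cmod (taylor_coef q 1))"
      using t by (intro mult_left_mono)
    ultimately show "t * cmod (taylor_coef q 2)
       \<le> 1 - (cmod a)\<^sup>2 - (1 - t\<^sup>2) * cmod (taylor_coef q 1) + 2 * t * cmod a * cmod (taylor_coef q 1)"
      by (simp add: algebra_simps)
  qed
qed

subsection \<open>Harmonic polynomials\<close>

text \<open>The weights \<open>k (k - 1)\<close> come from \<open>z\<^sup>2 * H''\<close>, the
  weights \<open>k (k + 1) = k (k - 1) + 2 k\<close> from
  \<open>2 * z * H' + z\<^sup>2 * H''\<close>.\<close>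

lemma convex_in_disk_polynomial:
  fixes a b :: "nat \<Rightarrow> complex"
  assumes pos: "\<And>z. z \<in> ball 0 R \<Longrightarrow>
      cmod (\<Sum>k=2..q. of_nat k * b k * z ^ (k - 1)) < Re (1 + (\<Sum>k=2..p. of_nat k * a k * z ^ (k - 1)))"
    and curv: "\<And>z. \<lbrakk>z \<in> ball 0 R; z \<noteq> 0\<rbrakk> \<Longrightarrow>
      cmod ((\<Sum>k=2..p. of_nat (k * (k - 1)) * a k * z ^ k) + cnj (\<Sum>k=2..q. of_nat (k * (k + 1)) * b k * z ^ k))
      < cmod (2 * z + (\<Sum>k=2..p. of_nat (k * (k + 1)) * a k * z ^ k) + cnj (\<Sum>k=2..q. of_nat (k * (k - 1)) * b k * z ^ k))"
  shows "convex_in_disk (\<lambda>z. z + (\<Sum>k=2..p. a k * z ^ k) + cnj (\<Sum>k=2..q. b k * z ^ k)) R"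
proof -
  have d1: "((\<lambda>z. \<Sum>k=2..n. c k * z ^ k) has_field_derivative (\<Sum>k=2..n. of_nat k * c k * z ^ (k - 1))) (at z)"
    for c :: "nat \<Rightarrow> complex" and n z
    by (auto intro!: derivative_eq_intros sum.cong simp: mult_ac)
  have d2: "((\<lambda>z. \<Sum>k=2..n. of_nat k * c k * z ^ (k - 1)) has_field_derivative (\<Sum>k=2..n. of_nat (k * (k - 1)) * c k * z ^ (k - 2))) (at z)"
    for c :: "nat \<Rightarrow> complex" and n z
    by (auto intro!: derivative_eq_intros sum.cong simp: mult_ac numeral_2_eq_2)
  have m1: "z * (\<Sum>k=2..n. of_nat k * c k * z ^ (k - 1)) = (\<Sum>k=2..n. of_nat k * c k * z ^ k)"
    for c :: "nat \<Rightarrow> complex" and n z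
    unfolding sum_distrib_left by (intro sum.cong refl) (auto simp: mult_ac power_eq_if)
  have m2: "z\<^sup>2 * (\<Sum>k=2..n. of_nat (k * (k - 1)) * c k * z ^ (k - 2)) = (\<Sum>k=2..n. of_nat (k * (k - 1)) * c k * z ^ k)"
    for c :: "nat \<Rightarrow> complex" and n z
    unfolding sum_distrib_left
  proof (intro sum.cong refl)
    fix k assume "k \<in> {2..n}"
    then have "z ^ k = z\<^sup>2 * z ^ (k - 2)"
      by (metis atLeastAtMost_iff le_add_diff_inverse power_add)
    then show "z\<^sup>2 * (of_nat (k * (k - 1)) * c k * z ^ (k - 2)) = of_nat (k * (k - 1)) * c k * z ^ k"
      by (simp only: mult_ac)
  qed
  have m3: "2 * (\<Sum>k=2..n. of_nat k * c k * z ^ k) + (\<Sum>k=2..n. of_nat (k * (k - 1)) * c k * z ^ k)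
      = (\<Sum>k=2..n. of_nat (k * (k + 1)) * c k * z ^ k)"
    for c :: "nat \<Rightarrow> complex" and n z
    unfolding sum_distrib_left sum.distrib[symmetric]
    by (intro sum.cong refl) (auto simp: algebra_simps of_nat_diff)
  have e1: "2 * z * (\<Sum>k=2..n. of_nat k * c k * z ^ (k - 1)) + z\<^sup>2 * (\<Sum>k=2..n. of_nat (k * (k - 1)) * c k * z ^ (k - 2))
      = (\<Sum>k=2..n. of_nat (k * (k + 1)) * c k * z ^ k)"
    for c :: "nat \<Rightarrow> complex" and n z
    unfolding m2 mult.assoc[of 2] m1 m3 ..
  have e2: "2 * z * (1 + (\<Sum>k=2..n. of_nat k * c k * z ^ (k - 1))) + z\<^sup>2 * (\<Sum>k=2..n. of_nat (k * (k - 1)) * c k * z ^ (k - 2))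
      = 2 * z + (\<Sum>k=2..n. of_nat (k * (k + 1)) * c k * z ^ k)"
    for c :: "nat \<Rightarrow> complex" and n z
    unfolding e1[symmetric] by (simp only: distrib_left mult_1_right add.assoc)
  interpret harmonic_disc "\<lambda>z. z + (\<Sum>k=2..p. a k * z ^ k)" "\<lambda>z. 1 + (\<Sum>k=2..p. of_nat k * a k * z ^ (k - 1))"
    "\<lambda>z. \<Sum>k=2..p. of_nat (k * (k - 1)) * a k * z ^ (k - 2)"
    "\<lambda>z. \<Sum>k=2..q. b k * z ^ k" "\<lambda>z. \<Sum>k=2..q. of_nat k * b k * z ^ (k - 1)"
    "\<lambda>z. \<Sum>k=2..q. of_nat (k * (k - 1)) * b k * z ^ (k - 2)" R
  proof
    fix z :: complex assume z: "z \<in> ball 0 R"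
    show "((\<lambda>z. z + (\<Sum>k=2..p. a k * z ^ k)) has_field_derivative 1 + (\<Sum>k=2..p. of_nat k * a k * z ^ (k - 1))) (at z)"
      by (intro DERIV_add DERIV_ident d1)
    show "((\<lambda>z. 1 + (\<Sum>k=2..p. of_nat k * a k * z ^ (k - 1))) has_field_derivative
        (\<Sum>k=2..p. of_nat (k * (k - 1)) * a k * z ^ (k - 2))) (at z)"
      using DERIV_add[OF DERIV_const d2] by simp
    show "cmod (\<Sum>k=2..q. of_nat k * b k * z ^ (k - 1)) < Re (1 + (\<Sum>k=2..p. of_nat k * a k * z ^ (k - 1)))"
      using pos[OF z] .
    assume "z \<noteq> 0"
    then show "cmod (z\<^sup>2 * (\<Sum>k=2..p. of_nat (k * (k - 1)) * a k * z ^ (k - 2)) +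
              cnj (2 * z * (\<Sum>k=2..q. of_nat k * b k * z ^ (k - 1)) +
                   z\<^sup>2 * (\<Sum>k=2..q. of_nat (k * (k - 1)) * b k * z ^ (k - 2))))
        < cmod (2 * z * (1 + (\<Sum>k=2..p. of_nat k * a k * z ^ (k - 1))) +
                z\<^sup>2 * (\<Sum>k=2..p. of_nat (k * (k - 1)) * a k * z ^ (k - 2)) +
                cnj (z\<^sup>2 * (\<Sum>k=2..q. of_nat (k * (k - 1)) * b k * z ^ (k - 2))))"
      unfolding e1 e2 unfolding m2 using curv[OF z] by blast
  qed (rule d1 d2)+
  show ?thesis using convex_in_disk .
qed

lemma norm_sum_le_sum:
  fixes c :: "nat \<Rightarrow> complex"
  assumes "cmod z = r" "\<And>k. k \<in> A \<Longrightarrow> 0 \<le> u k"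
  shows "cmod (\<Sum>k\<in>A. of_real (u k) * c k * z ^ f k) \<le> (\<Sum>k\<in>A. u k * cmod (c k) * r ^ f k)"
  using assms by (intro order_trans[OF norm_sum] sum_mono) (simp add: norm_mult norm_power)

text \<open>By the triangle inequality the two sides of the curvature condition contribute the
  weights \<open>k (k - 1) + k (k + 1) = 2 k\<^sup>2\<close>, to be beaten by the leading term
  \<open>2 r\<close>. Positivity follows from \<open>k <= k\<^sup>2\<close>.\<close>

lemma convex_in_disk_of_coef_sum:
  fixes a b :: "nat \<Rightarrow> complex"
  assumes small: "\<And>r. \<lbrakk>0 \<le> r; r < R\<rbrakk> \<Longrightarrow>
    (\<Sum>k=2..p. (real k)\<^sup>2 * cmod (a k) * r ^ (k - 1)) + (\<Sum>k=2..q. (real k)\<^sup>2 * cmod (b k) * r ^ (k - 1)) < 1"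
  shows "convex_in_disk (\<lambda>z. z + (\<Sum>k=2..p. a k * z ^ k) + cnj (\<Sum>k=2..q. b k * z ^ k)) R"
proof (rule convex_in_disk_polynomial)
  have mono: "(\<Sum>k=2..n. real k * cmod (c k) * r ^ (k - 1)) \<le> (\<Sum>k=2..n. (real k)\<^sup>2 * cmod (c k) * r ^ (k - 1))"
    if "r \<ge> 0" for c :: "nat \<Rightarrow> complex" and r n
    using that by (intro sum_mono mult_right_mono) (auto simp: power2_eq_square)
  fix z :: complex assume z: "z \<in> ball 0 R"
  define r where "r = cmod z"
  have r: "0 \<le> r" "r < R" "cmod z = r" using z by (auto simp: r_def)
  have bd1: "cmod (\<Sum>k=2..n. of_nat k * c k * z ^ (k - 1)) \<le> (\<Sum>k=2..n. real k * cmod (c k) * r ^ (k - 1))"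
    for c :: "nat \<Rightarrow> complex" and n
    using norm_sum_le_sum[OF r(3), of "{2..n}" real c "\<lambda>k. k - 1"] by simp
  have "- cmod (\<Sum>k=2..p. of_nat k * a k * z ^ (k - 1)) \<le> Re (\<Sum>k=2..p. of_nat k * a k * z ^ (k - 1))"
    using abs_Re_le_cmod[of "\<Sum>k=2..p. of_nat k * a k * z ^ (k - 1)"] by linarith
  then show "cmod (\<Sum>k=2..q. of_nat k * b k * z ^ (k - 1)) < Re (1 + (\<Sum>k=2..p. of_nat k * a k * z ^ (k - 1)))"
    using small[OF r(1,2)] mono[OF r(1), of a p] mono[OF r(1), of b q] bd1[of a p] bd1[of b q]
    unfolding plus_complex.sel one_complex.sel by linarith
  assume "z \<noteq> 0"
  then have "r > 0" by (simp add: r_def)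
  define M where "M c n = (\<Sum>k=2..n. real (k * (k - 1)) * cmod (c k) * r ^ k)" for c :: "nat \<Rightarrow> complex" and n
  define L where "L c n = (\<Sum>k=2..n. real (k * (k + 1)) * cmod (c k) * r ^ k)" for c :: "nat \<Rightarrow> complex" and n
  have bM: "cmod (\<Sum>k=2..n. of_nat (k * (k - 1)) * c k * z ^ k) \<le> M c n" for c n
    using norm_sum_le_sum[OF r(3), of "{2..n}" "\<lambda>k. real (k * (k - 1))" c "\<lambda>k. k"] by (simp add: M_def)
  have bL: "cmod (\<Sum>k=2..n. of_nat (k * (k + 1)) * c k * z ^ k) \<le> L c n" for c n
    using norm_sum_le_sum[OF r(3), of "{2..n}" "\<lambda>k. real (k * (k + 1))" c "\<lambda>k. k"] by (simp add: L_def)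
  have sum_ML: "M c n + L c n = 2 * r * (\<Sum>k=2..n. (real k)\<^sup>2 * cmod (c k) * r ^ (k - 1))" for c n
    unfolding M_def L_def sum.distrib[symmetric] sum_distrib_left
    by (intro sum.cong refl) (auto simp: power_eq_if[of r] of_nat_diff algebra_simps power2_eq_square)
  have "M a p + L a p + (M b q + L b q) < 2 * r"
    unfolding sum_ML using mult_strict_left_mono[OF small[OF r(1,2)], of "2 * r"] \<open>r > 0\<close> by (simp add: algebra_simps)
  moreover have "cmod (2 * z) = 2 * r" by (simp add: norm_mult r_def)
  ultimately show "cmod ((\<Sum>k=2..p. of_nat (k * (k - 1)) * a k * z ^ k) + cnj (\<Sum>k=2..q. of_nat (k * (k + 1)) * b k * z ^ k))
      < cmod (2 * z + (\<Sum>k=2..p. of_nat (k * (k + 1)) * a k * z ^ k) + cnj (\<Sum>k=2..q. of_nat (k * (k - 1)) * b k * z ^ k))"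
    (is "cmod (?x + cnj ?y) < cmod (2 * z + ?u + cnj ?v)")
    using bM[of a p] bL[of b q] bL[of a p] bM[of b q]
      norm_triangle_ineq[of ?x "cnj ?y"] norm_diff_ineq[of "2 * z + ?u" "cnj ?v"] norm_diff_ineq[of "2 * z" ?u]
    unfolding complex_mod_cnj by linarith
qed

lemma sum_deriv_geometric_le:
  fixes x :: real
  assumes "0 \<le> x" "x < 1"
  shows "(\<Sum>k=1..n. real k * x ^ (k - 1)) \<le> 1 / (1 - x)\<^sup>2"
proof -
  have "(1 - x)\<^sup>2 * (\<Sum>k=1..n. real k * x ^ (k - 1)) = 1 - (real n + 1) * x ^ n + real n * x ^ Suc n"
    by (induction n) (simp_all add: algebra_simps power2_eq_square)
  also have "\<dots> \<le> 1"
  proof -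
    have "real n * x ^ Suc n \<le> (real n + 1) * x ^ n"
      using assms by (intro mult_mono) (auto intro: power_decreasing_iff[THEN iffD2] simp: mult_left_le_one_le)
    then show ?thesis by simp
  qed
  finally show ?thesis using assms by (simp add: pos_le_divide_eq mult.commute)
qed

subsection \<open>Estimates for the sections\<close>

lemma sum_deriv_geometric_tail_le:
  fixes x :: real
  assumes "0 \<le> x" "x < 1"
  shows "(\<Sum>k=Suc m..n. real k * x ^ (k - 1)) \<le> 1 / (1 - x)\<^sup>2 - (\<Sum>k=1..m. real k * x ^ (k - 1))"
proof -
  have "(\<Sum>k=1..m. real k * x ^ (k - 1)) + (\<Sum>k=Suc m..n. real k * x ^ (k - 1))
      = (\<Sum>k\<in>{1..m} \<union> {Suc m..n}. real k * x ^ (k - 1))"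
    by (rule sum.union_disjoint[symmetric]) auto
  also have "\<dots> \<le> (\<Sum>k=1..m + n. real k * x ^ (k - 1))"
    using assms by (intro sum_mono2) auto
  also have "\<dots> \<le> 1 / (1 - x)\<^sup>2" using sum_deriv_geometric_le[OF assms] .
  finally show ?thesis by simp
qed

section \<open>Inequalities behind the two radii\<close>

lemma positive_before_smallest_root:
  assumes "smallest_root_01 p R" "\<And>x. isCont p x" "p 0 > 0" "0 \<le> r" "r < R"
  shows "p r > 0"
proof (rule ccontr)
  assume "\<not> p r > 0"
  then have "\<exists>x. 0 \<le> x \<and> x \<le> r \<and> p x = 0"
    using assms by (intro IVT2) auto
  then obtain x where "0 \<le> x" "x \<le> r" "p x = 0" by blast
  moreover from this have "x \<noteq> 0" using assms(3) by auto
  ultimately show False using assms(1,5) unfolding smallest_root_01_def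
    by (metis le_less_trans order_le_less)
qed

text \<open>The bracket adds \<open>4 r\<close>, from \<open>p1 + q1 <= 2 (1 - \<beta>)\<close>, to
  the series of \<open>k r^(k-1)\<close> from \<open>k = 3\<close> on. Both the claim and
  \<open>P1\<close> are affine in \<open>\<beta>\<close>: \<open>P1 > 0\<close> says
  \<open>(1 - \<beta>) r K < (1 - r)\<^sup>2 A\<close> and the claim says
  \<open>(1 - \<beta>) r B < (1 - r)\<^sup>2\<close>, so \<open>A * B <= K\<close> suffices.\<close>

lemma coef_sum_bound_of_P1_pos:
  assumes \<beta>: "\<beta> < 1" and r: "213/1000 \<le> r" "r < 1" and pos: "P1 \<beta> r > 0"
  shows "(1 - \<beta>) * (1 / (1 - r)\<^sup>2 - 1 + 2 * r) < 1"
proof -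
  define A where "A = 1 - 2 * r - r\<^sup>2"
  define B where "B = 4 - 5 * r + 2 * r\<^sup>2"
  define K where "K = 2 * r * (1 + r)\<^sup>2 * (3 - 2 * r)"
  have K: "K > 0" using r by (simp add: K_def)
  have B: "B > 0"
  proof -
    have "B = 2 * (r - 5/4)\<^sup>2 + 7/8" by (simp add: B_def power2_eq_square algebra_simps)
    then show ?thesis by (simp add: add_nonneg_pos)
  qed
  have "P1 \<beta> r = (1 - r)\<^sup>2 * A - (1 - \<beta>) * r * K"
    by (simp add: P1_def A_def K_def power2_eq_square power3_eq_cube power4_eq_xxxx eval_nat_numeral algebra_simps)
  then have 1: "(1 - \<beta>) * r * K < (1 - r)\<^sup>2 * A" using pos by simp
  have "0 < (1 - \<beta>) * r * K" using \<beta> r K by simp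
  then have "0 < (1 - r)\<^sup>2 * A" using 1 by linarith
  then have "A > 0" using zero_less_mult_pos[of "(1 - r)\<^sup>2" A] r by simp
  then have "r < 1 / 2" using zero_le_power2[of r] unfolding A_def by linarith
  \<comment> \<open>\<open>K - A * B\<close> changes sign between \<open>0.212\<close> and
    \<open>0.213\<close>, whence the cut-off \<open>213/1000\<close>.\<close>
  have AB: "A * B \<le> K"
  proof -
    let ?x = "r - 213/1000"
    have "r ^ 3 - c ^ 3 = (r - c) * (r\<^sup>2 + c * r + c\<^sup>2)" for c
      by (simp add: power2_eq_square power3_eq_cube algebra_simps)
    then have "r ^ 3 - (213/1000) ^ 3 = ?x * (r\<^sup>2 + 213/1000 * r + (213/1000)\<^sup>2)" .
    also have "\<dots> \<le> ?x * 1"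
    proof (intro mult_left_mono)
      have "r * r \<le> 1/2 * (1/2)" using r \<open>r < 1/2\<close> by (intro mult_mono) auto
      then show "r\<^sup>2 + 213/1000 * r + (213/1000)\<^sup>2 \<le> 1"
        using \<open>r < 1/2\<close> by (simp add: power2_eq_square)
    qed (use r in auto)
    finally have c3: "r ^ 3 \<le> 9663597/1000000000 + ?x" by (simp add: power3_eq_cube)
    have "K - A * B = - 4 + 19 * r - 3 * r ^ 3 - 2 * r ^ 4"
      by (simp add: A_def B_def K_def power2_eq_square power3_eq_cube power4_eq_xxxx algebra_simps)
    moreover have "r * r ^ 3 \<le> 1/2 * r ^ 3"
      using r \<open>r < 1/2\<close> by (intro mult_right_mono) auto
    then have "r ^ 4 \<le> 1/2 * r ^ 3" by (simp add: eval_nat_numeral)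
    ultimately show ?thesis using c3 r by linarith
  qed
  have "(1 - \<beta>) * r * B * K < (1 - r)\<^sup>2 * (A * B)"
    using mult_strict_right_mono[OF 1 B] by (simp add: mult_ac)
  also have "\<dots> \<le> (1 - r)\<^sup>2 * K" using AB by (intro mult_left_mono) auto
  finally have "(1 - \<beta>) * r * B < (1 - r)\<^sup>2" using K by simp
  moreover have "r * B = (1 / (1 - r)\<^sup>2 - 1 + 2 * r) * (1 - r)\<^sup>2"
  proof -
    have "(1 / Q - 1 + 2 * r) * Q = 1 + (2 * r - 1) * Q" if "Q \<noteq> 0" for Q
      using that by (simp add: algebra_simps)
    moreover have "(1 - r)\<^sup>2 \<noteq> 0" using r by simp
    ultimately have "(1 / (1 - r)\<^sup>2 - 1 + 2 * r) * (1 - r)\<^sup>2 = 1 + (2 * r - 1) * (1 - r)\<^sup>2" .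
    then show ?thesis by (simp add: B_def power2_eq_square algebra_simps)
  qed
  ultimately have "(1 - \<beta>) * (1 / (1 - r)\<^sup>2 - 1 + 2 * r) * (1 - r)\<^sup>2 < 1 * (1 - r)\<^sup>2"
    by (simp add: mult.assoc)
  then show ?thesis by (rule mult_right_less_imp_less) simp
qed

text \<open>Here \<open>u = Re v + s\<close> measures the departure from \<open>v = -s\<close>. The
  two moduli are bounded, from below and above, by affine functions of \<open>u\<close> with the
  same slope \<open>2 * s / m\<close>; their difference is \<open>m\<^sup>2\<close>, the left-hand
  side.\<close>

lemma quadratic_norm_bound:
  assumes s: "cmod v = s" "s \<le> 234/1000"
  shows "1 - 4 * s + 4 * s\<^sup>2 \<le> cmod (1 + 3 * v + 4 * v\<^sup>2) - cmod (v + 2 * v\<^sup>2)"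
proof -
  have s0: "0 \<le> s" using s by auto
  define X where "X = Re v"
  define u where "u = X + s"
  define m where "m = 1 - 2 * s"
  have m: "m \<ge> 532/1000" using s by (simp add: m_def)
  have u: "u \<ge> 0" using abs_Re_le_cmod[of v] s unfolding u_def X_def by linarith
  have s2: "s\<^sup>2 = (Re v)\<^sup>2 + (Im v)\<^sup>2" using s cmod_power2 by metis
  have "(cmod (1 + 2 * v))\<^sup>2 = m\<^sup>2 + 4 * u"
    unfolding cmod_power2 using s2 by (simp add: m_def u_def X_def power2_eq_square algebra_simps)
  also have "\<dots> \<le> (m + 2 * u / m)\<^sup>2"
    using m by (simp add: power2_sum)
  finally have "cmod (1 + 2 * v) \<le> m + 2 * u / m"
    by (rule power2_le_imp_le) (use m u in auto)
  then have "s * cmod (1 + 2 * v) \<le> s * (m + 2 * u / m)" using s0 by (rule mult_left_mono)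
  moreover have "cmod (v + 2 * v\<^sup>2) = s * cmod (1 + 2 * v)"
  proof -
    have "v + 2 * v\<^sup>2 = v * (1 + 2 * v)" by (simp add: power2_eq_square algebra_simps)
    then show ?thesis unfolding s(1)[symmetric] by (simp only: norm_mult)
  qed
  ultimately have upper: "cmod (v + 2 * v\<^sup>2) \<le> s * m + 2 * s * u / m" by (simp add: algebra_simps)
  define T where "T = m * (1 - s) + 2 * (s * u / m)"
  have "T\<^sup>2 \<le> (cmod (1 + 3 * v + 4 * v\<^sup>2))\<^sup>2"
  proof -
    have "(cmod (1 + 3 * v + 4 * v\<^sup>2))\<^sup>2 = 1 + s\<^sup>2 + 16 * (s\<^sup>2)\<^sup>2 + (6 + 24 * s\<^sup>2) * X + 16 * X\<^sup>2"
      unfolding cmod_power2 s2 X_def by (simp add: power2_eq_square algebra_simps)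
    also have "\<dots> = m\<^sup>2 * (1 - s)\<^sup>2 + 4 * s * (1 - s) * u + (4 * s\<^sup>2 * (1 - 3 * s + 3 * s\<^sup>2) + (6 - 36 * s + 28 * s\<^sup>2) * u + 16 * u\<^sup>2)"
    proof -
      have X: "X = u - s" by (simp add: u_def)
      show ?thesis unfolding X m_def by (simp add: power2_eq_square algebra_simps)
    qed
    finally have eq: "(cmod (1 + 3 * v + 4 * v\<^sup>2))\<^sup>2 = \<dots>" .
    \<comment> \<open>Since \<open>s <= 1/4\<close>, the quotient \<open>s / m\<close> is at most
      \<open>1/2\<close>; this square then costs one \<open>u\<^sup>2\<close> out of the available
      \<open>16 * u\<^sup>2\<close>.\<close>
    have "(s * u / m)\<^sup>2 \<le> (1/2 * u)\<^sup>2"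
    proof (rule power_mono)
      have "s * u / m \<le> (m / 2) * u / m" using s m u s0 
        by (intro divide_right_mono mult_right_mono) (auto simp: m_def)
      then show "s * u / m \<le> 1/2 * u" using m by simp
    qed (use s0 m u in auto)
    moreover have "(1/2 * u)\<^sup>2 = u\<^sup>2 / 4" by (simp add: power2_eq_square)
    ultimately have q: "4 * (s * u / m)\<^sup>2 \<le> u\<^sup>2" by linarith
    have T2: "T\<^sup>2 = m\<^sup>2 * (1 - s)\<^sup>2 + 4 * s * (1 - s) * u + 4 * (s * u / m)\<^sup>2"
    proof -
      define w where "w = s * u / m"
      have "m * w = s * u" using m by (simp add: w_def)
      moreover have "(m * (1 - s) + 2 * w)\<^sup>2 = m\<^sup>2 * (1 - s)\<^sup>2 + 4 * (1 - s) * (m * w) + 4 * w\<^sup>2"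
        by (simp add: power2_eq_square algebra_simps)
      ultimately show ?thesis unfolding T_def w_def[symmetric] by (simp add: algebra_simps)
    qed
    have "0 \<le> 4 * s\<^sup>2 * (1 - 3 * s + 3 * s\<^sup>2) + (6 - 36 * s + 28 * s\<^sup>2) * u + 15 * u\<^sup>2"
    \<comment> \<open>The coefficient of \<open>u\<close> is negative only for \<open>s\<close>
      above about \<open>0.197\<close>. There it is at least \<open>-1\<close> and the constant term
      at least \<open>1/60\<close>, so completing the square at \<open>u = 1/30\<close>
      suffices.\<close>
    proof (cases "0 \<le> 6 - 36 * s + 28 * s\<^sup>2")
      case True
      then have "0 \<le> (6 - 36 * s + 28 * s\<^sup>2) * u" using u by (rule mult_nonneg_nonneg)
      moreover have "0 \<le> 1 - 3 * s + 3 * s\<^sup>2" using s by (simp add: add_nonneg_nonneg)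
      then have "0 \<le> 4 * s\<^sup>2 * (1 - 3 * s + 3 * s\<^sup>2)" by (intro mult_nonneg_nonneg) auto
      ultimately show ?thesis by simp
    next
      case False
      have "s \<ge> 19/100"
      proof (rule ccontr)
        assume "\<not> 19/100 \<le> s"
        then have "0 \<le> (19/100 - s) * (3068/100 - 28 * s)" using s by (intro mult_nonneg_nonneg) auto
        moreover have "(c - s) * (d - 28 * s) = c * d - (28 * c + d) * s + 28 * s\<^sup>2" for c d
          by (simp add: power2_eq_square algebra_simps)
        ultimately have "0 \<le> 19/100 * (3068/100) - (28 * (19/100) + 3068/100) * s + 28 * s\<^sup>2" by metis
        then show False using False by simp
      qed
      then have ss: "s\<^sup>2 \<ge> (19/100)\<^sup>2" by (intro power_mono) auto
      then have "s\<^sup>2 * (1 - 3 * s + 3 * s\<^sup>2) \<ge> (19/100)\<^sup>2 * (4/10)"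
        using s by (intro mult_mono) (auto simp: power2_eq_square)
      then have "4 * s\<^sup>2 * (1 - 3 * s + 3 * s\<^sup>2) \<ge> 1/60" by (simp add: power2_eq_square)
      moreover have "6 - 36 * s + 28 * s\<^sup>2 \<ge> - 1"
        using zero_le_power2[of "s - 234/1000"] s(2) by (simp add: power2_eq_square algebra_simps)
      then have "(6 - 36 * s + 28 * s\<^sup>2) * u \<ge> (- 1) * u" using u by (intro mult_right_mono) auto
      moreover have "15 * (u - 1/30)\<^sup>2 = 15 * u\<^sup>2 - u + 1/60" by (simp add: power2_eq_square algebra_simps)
      then have "15 * u\<^sup>2 - u + 1/60 \<ge> 0" by (metis mult_nonneg_nonneg zero_le_power2 zero_le_numeral)
      ultimately show ?thesis by linarith
    qed
    then show ?thesis unfolding eq T2 using q by linarith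
  qed
  then have "T \<le> cmod (1 + 3 * v + 4 * v\<^sup>2)" by (rule power2_le_imp_le) simp
  then show ?thesis using upper m unfolding T_def m_def by (simp add: power2_eq_square algebra_simps)
qed

text \<open>The left side is concave for \<open>x >= 0\<close>, with maximum about
  \<open>0.933\<close> near \<open>0.733\<close>. Tangents to \<open>x ^ 3\<close> at
  \<open>0.73\<close> and to \<open>x\<^sup>2\<close> at \<open>0.738\<close> leave an affine bound
  of slightly negative slope.\<close>

lemma cubic_estimate:
  fixes x :: real
  assumes "0 \<le> x"
  shows "852/1000 * x + (1 - x\<^sup>2) * (4668321/10000000 + 272214/1000000 * x) < 9475/10000"
proof -
  have "(x - c)\<^sup>2 * (x + 2 * c) = x ^ 3 - 3 * c\<^sup>2 * x + 2 * c ^ 3" for c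
    by (simp add: power2_eq_square power3_eq_cube algebra_simps)
  moreover have "0 \<le> (x - 73/100)\<^sup>2 * (x + 2 * (73/100))" using assms by simp
  ultimately have "0 \<le> x ^ 3 - 3 * (73/100)\<^sup>2 * x + 2 * (73/100) ^ 3" by metis
  then have "15987/10000 * x \<le> x ^ 3 + 778034/1000000" by (simp add: power2_eq_square power3_eq_cube)
  moreover have "2 * c * x \<le> x\<^sup>2 + c\<^sup>2" for c :: real
    using zero_le_power2[of "x - c"] by (simp add: power2_eq_square algebra_simps)
  from this[of "738/1000"] have "1476/1000 * x \<le> x\<^sup>2 + 544644/1000000" by (simp add: power2_eq_square)
  moreover have "852/1000 * x + (1 - x\<^sup>2) * (4668321/10000000 + 272214/1000000 * x)
      = 4668321/10000000 + 1124214/1000000 * x - 4668321/10000000 * x\<^sup>2 - 272214/1000000 * x ^ 3"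
    by (simp add: power2_eq_square power3_eq_cube field_simps)
  ultimately show ?thesis using assms by linarith
qed

lemma (in dominated_pair) dominated_pair_0: "0 \<le> \<beta> \<Longrightarrow> dominated_pair P q 0"
proof
  fix z :: complex assume "0 \<le> \<beta>" "z \<in> ball 0 1"
  then show "cmod (q z) \<le> Re (P z) - 0" using dominated[of z] by simp
qed (rule P_hol q_hol P_0 q_0)+

text \<open>For \<open>r \<ge> 0.213\<close> the crude coefficient bounds suffice; for smaller \<open>r\<close> they fail when \<open>\<beta>\<close> is near
  \<open>0\<close>, and the relations between the first coefficients are needed (with \<open>\<beta> = 0\<close>).\<close>

lemma (in dominated_pair) coef_sum_less_1:
  assumes \<beta>: "0 \<le> \<beta>" "\<beta> < 1" and r: "0 \<le> r" "r < R" and R: "smallest_root_01 (P1 \<beta>) R"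
  shows "2 * cmod (taylor_coef P 1) * r + (\<Sum>k=2..n. real k * cmod (taylor_coef q (k - 1)) * r ^ (k - 1)) < 1"
    (is "?S r < 1")
proof -
  have r1: "r < 1" using r R by (simp add: smallest_root_01_def)
  have split: "(\<Sum>k=2..n. f k) \<le> f 2 + (\<Sum>k=3..n. f k)" "(\<Sum>k=3..n. f k) \<le> f 3 + (\<Sum>k=4..n. f k)"
    if "\<And>k. f k \<ge> 0" for f :: "nat \<Rightarrow> real"
  proof -
    have "(\<Sum>k=m..n. f k) \<le> f m + (\<Sum>k=Suc m..n. f k)" for m
      using that by (cases "m \<le> n") (simp_all add: sum.atLeast_Suc_atMost)
    from this[of 2] this[of 3] show "(\<Sum>k=2..n. f k) \<le> f 2 + (\<Sum>k=3..n. f k)" "(\<Sum>k=3..n. f k) \<le> f 3 + (\<Sum>k=4..n. f k)"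
      by (simp_all add: eval_nat_numeral)
  qed
  define p1 q1 q2 where "p1 = cmod (taylor_coef P 1)" and "q1 = cmod (taylor_coef q 1)" and "q2 = cmod (taylor_coef q 2)"
  have tail: "(\<Sum>k=m..n. real k * cmod (taylor_coef q (k - 1)) * x ^ (k - 1)) \<le> (1 - \<beta>) * (\<Sum>k=m..n. real k * x ^ (k - 1))"
    if "0 \<le> x" for m x
    unfolding sum_distrib_left
  proof (rule sum_mono)
    fix k
    have "real k * x ^ (k - 1) * cmod (taylor_coef q (k - 1)) \<le> real k * x ^ (k - 1) * (1 - \<beta>)"
      using that by (intro mult_left_mono q_coef_bound) auto
    then show "real k * cmod (taylor_coef q (k - 1)) * x ^ (k - 1) \<le> (1 - \<beta>) * (real k * x ^ (k - 1))"
      by (simp only: mult_ac)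
  qed
  have first: "(\<Sum>k=2..n. real k * cmod (taylor_coef q (k - 1)) * x ^ (k - 1))
      \<le> 2 * q1 * x + (\<Sum>k=3..n. real k * cmod (taylor_coef q (k - 1)) * x ^ (k - 1))" if "0 \<le> x" for x
    using split(1)[of "\<lambda>k. real k * cmod (taylor_coef q (k - 1)) * x ^ (k - 1)"] that by (simp add: q1_def)
  have p1q1: "p1 + q1 \<le> 2 * (1 - \<beta>)" using sum_coef_bound[of 1] by (simp add: p1_def q1_def)
  show ?thesis
  proof (cases "213/1000 \<le> r")
    case True
    have "P1 \<beta> r > 0"
      by (rule positive_before_smallest_root[OF R _ _ r]) (auto simp: P1_def[abs_def] intro!: continuous_intros)
    from coef_sum_bound_of_P1_pos[OF \<beta>(2) True r1 this]
    have bound: "(1 - \<beta>) * (1 / (1 - r)\<^sup>2 - 1 + 2 * r) < 1" .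
    have "(\<Sum>k=3..n. real k * r ^ (k - 1)) \<le> 1 / (1 - r)\<^sup>2 - (1 + 2 * r)"
      using sum_deriv_geometric_tail_le[OF r(1) r1, of 2 n] by (simp add: eval_nat_numeral)
    then have "(1 - \<beta>) * (\<Sum>k=3..n. real k * r ^ (k - 1)) \<le> (1 - \<beta>) * (1 / (1 - r)\<^sup>2 - (1 + 2 * r))"
      using \<beta> by (intro mult_left_mono) auto
    moreover have "2 * r * (p1 + q1) \<le> 2 * r * (2 * (1 - \<beta>))" using p1q1 r by (intro mult_left_mono) auto
    ultimately show ?thesis
      using first[OF r(1)] tail[OF r(1), of 3] bound unfolding p1_def[symmetric] by (simp add: algebra_simps)
  next
    case False
    \<comment> \<open>The terms of \<open>?S\<close> do not decrease as the radius grows, so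
      bounding \<open>?S ?x\<close> is enough.\<close>
    let ?x = "213/1000 :: real"
    interpret zero: dominated_pair P q 0
      by (rule dominated_pair_0[OF \<beta>(1)])
    obtain a b where ab: "taylor_coef P 1 = 2 * a" "q1 \<le> 1 - (cmod a)\<^sup>2 - (cmod b)\<^sup>2"
      "\<And>t. \<lbrakk>0 \<le> t; t < 1\<rbrakk> \<Longrightarrow> t * q2 \<le> 1 - (cmod a)\<^sup>2 - (1 - t\<^sup>2) * q1 + 2 * t * cmod a * q1"
      using zero.second_order_coefs unfolding q1_def q2_def by (metis (no_types, lifting))
    define \<rho> where "\<rho> = cmod a"
    have \<rho>: "\<rho> \<ge> 0" by (simp add: \<rho>_def)
    have y: "q1 \<le> 1 - \<rho>\<^sup>2" using ab(2) unfolding \<rho>_def by (smt (verit) zero_le_power2)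
    \<comment> \<open>The relation is taken at \<open>t = 3/10\<close>. Multiplied by
      \<open>45369/100000 = 10 * ?x\<^sup>2\<close> it bounds \<open>3 * q2 * ?x\<^sup>2\<close> and
      leads to the left side of \<open>cubic_estimate\<close>, whose bound \<open>9475/10000\<close>
      leaves \<open>525/10000\<close> for the terms from \<open>k = 4\<close> on.\<close>
    have q2: "3/10 * q2 \<le> 1 - \<rho>\<^sup>2 - 91/100 * q1 + 6/10 * \<rho> * q1"
      using ab(3)[of "3/10"] by (simp add: \<rho>_def power2_eq_square)
    define E where "E = (131421/10000000 + 272214/1000000 * \<rho>) * (1 - \<rho>\<^sup>2)"
    have "(131421/10000000 + 272214/1000000 * \<rho>) * q1 \<le> E"
      unfolding E_def using y \<rho> by (intro mult_left_mono) auto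
    then have E1: "131421/10000000 * q1 + 272214/1000000 * (\<rho> * q1) \<le> E"
      by (simp only: distrib_right mult.assoc)
    have "(1 - \<rho>\<^sup>2) * ((c + d) + e) = c * (1 - \<rho>\<^sup>2) + (d + e) * (1 - \<rho>\<^sup>2)" for c d e
      by (simp add: algebra_simps)
    from this[of "45369/100000" "131421/10000000" "272214/1000000 * \<rho>"]
    have "(1 - \<rho>\<^sup>2) * (4668321/10000000 + 272214/1000000 * \<rho>) = 45369/100000 * (1 - \<rho>\<^sup>2) + E"
      unfolding E_def by simp
    then have E2: "852/1000 * \<rho> + (45369/100000 * (1 - \<rho>\<^sup>2) + E) < 9475/10000"
      using cubic_estimate[OF \<rho>] by simp
    have E3: "4 * \<rho> * ?x + 2 * q1 * ?x + 3 * q2 * ?x\<^sup>2 = 852/1000 * \<rho> + 426/1000 * q1 + 136107/1000000 * q2"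
      by (simp add: power2_eq_square)
    have "3/10 * q2 \<le> 1 - \<rho>\<^sup>2 - 91/100 * q1 + 6/10 * (\<rho> * q1)" using q2 by simp
    then have "45369/100000 * (3/10 * q2) \<le> 45369/100000 * (1 - \<rho>\<^sup>2 - 91/100 * q1 + 6/10 * (\<rho> * q1))"
      by (rule mult_left_mono) simp
    then have "136107/1000000 * q2 \<le> 45369/100000 * (1 - \<rho>\<^sup>2) - 4128579/10000000 * q1 + 272214/1000000 * (\<rho> * q1)"
      by argo
    then have main: "4 * \<rho> * ?x + 2 * q1 * ?x + 3 * q2 * ?x\<^sup>2 < 9475/10000"
      unfolding E3 using E1 E2 by argo
    have "(\<Sum>k=4..n. real k * ?x ^ (k - 1)) \<le> 1 / (1 - ?x)\<^sup>2 - (1 + 2 * ?x + 3 * ?x\<^sup>2)"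
      using sum_deriv_geometric_tail_le[of ?x 3 n] by (simp add: eval_nat_numeral)
    also have "\<dots> \<le> 525/10000" by (simp add: power2_eq_square)
    finally have t4: "(\<Sum>k=4..n. real k * ?x ^ (k - 1)) \<le> 525/10000" .
    have "?S r \<le> ?S ?x"
      using False r by (intro add_mono mult_left_mono sum_mono power_mono) auto
    moreover have "(\<Sum>k=3..n. real k * cmod (taylor_coef q (k - 1)) * ?x ^ (k - 1))
        \<le> 3 * q2 * ?x\<^sup>2 + (\<Sum>k=4..n. real k * cmod (taylor_coef q (k - 1)) * ?x ^ (k - 1))"
      using split(2)[of "\<lambda>k. real k * cmod (taylor_coef q (k - 1)) * ?x ^ (k - 1)"] by (simp add: q2_def)
    moreover have "(\<Sum>k=4..n. real k * cmod (taylor_coef q (k - 1)) * ?x ^ (k - 1)) \<le> 525/10000"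
    proof -
      have "(\<Sum>k=4..n. real k * cmod (taylor_coef q (k - 1)) * ?x ^ (k - 1)) \<le> (\<Sum>k=4..n. real k * ?x ^ (k - 1))"
        using zero.q_coef_bound by (intro sum_mono mult_right_mono) (auto intro!: mult_right_le_one_le)
      then show ?thesis using t4 by linarith
    qed
    moreover have "2 * cmod (taylor_coef P 1) * ?x = 4 * \<rho> * ?x" unfolding ab(1) \<rho>_def by (simp add: norm_mult)
    ultimately show ?thesis using first[of ?x] main by linarith
  qed
qed

text \<open>At \<open>234/1000\<close> already \<open>P2 0\<close> is nonpositive, and
  \<open>P2\<close> decreases in \<open>\<beta>\<close> there, whereas it is positive before its
  first root.\<close>

lemma P2_root_le:
  assumes \<beta>: "0 \<le> \<beta>" and R: "smallest_root_01 (P2 \<beta>) R"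
  shows "R \<le> 234/1000"
proof (rule ccontr)
  assume R_large: "\<not> R \<le> 234/1000"
  have pos: "P2 \<beta> (234/1000) > 0"
    by (rule positive_before_smallest_root[OF R])
      (use R_large in \<open>auto simp: P2_def[abs_def] intro!: continuous_intros\<close>)
  define D where "D x = x ^ 2 - 3 * x ^ 3 - 2 * x ^ 4 - 3 * x ^ 5 + 3 * x ^ 6" for x :: real
  have "P2 \<beta> x = P2 0 x - \<beta> * D x" for x by (simp add: P2_def D_def algebra_simps)
  from this[of "234/1000"] have "P2 \<beta> (234/1000) = P2 0 (234/1000) - \<beta> * D (234/1000)" .
  moreover have "P2 0 (234/1000) \<le> 0" by (simp add: P2_def eval_nat_numeral)
  moreover have "0 \<le> \<beta> * D (234/1000)" using \<beta> by (simp add: D_def eval_nat_numeral)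
  ultimately show False using pos by linarith
qed

text \<open>With \<open>a\<close>, \<open>b\<close> as in \<open>second_order_coefs\<close>, \<open>\<rho> = |a|\<close> and \<open>k = |b|\<close>: since \<open>y \<le> 1 - \<rho>\<^sup>2 - k\<^sup>2\<close>, a large \<open>k\<close> is paid for
  by a small \<open>y\<close>, and \<open>6 k r\<^sup>2 - 2 k\<^sup>2 r \<le> (9/2) r\<^sup>3\<close>.\<close>

lemma curvature_estimate:
  fixes r \<rho> k y :: real
  assumes r: "0 < r" "r \<le> 234/1000" and \<rho>: "0 \<le> \<rho>" "\<rho> \<le> 1" and y: "y \<le> 1 - \<rho>\<^sup>2 - k\<^sup>2"
  shows "6 * k * r\<^sup>2 + 2 * y * r + 14404/100000 < 1 - 4 * (\<rho> * r) + 4 * (\<rho> * r)\<^sup>2"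
proof -
  let ?c = "234/1000 :: real"
  have "0 \<le> 2 * r * (k - 3/2 * r)\<^sup>2" using r by simp
  also have "\<dots> = 2 * r * k\<^sup>2 - 6 * k * r\<^sup>2 + 9/2 * r ^ 3"
    by (simp add: power2_eq_square power3_eq_cube algebra_simps)
  finally have k: "6 * k * r\<^sup>2 \<le> 2 * r * k\<^sup>2 + 9/2 * r ^ 3" by simp
  have "r ^ 3 \<le> ?c ^ 3" using r by (intro power_mono) auto
  then have r3: "9/2 * r ^ 3 \<le> 5766/100000" by (simp add: power3_eq_cube)
  have y': "2 * y * r \<le> 2 * r - 2 * r * \<rho>\<^sup>2 - 2 * r * k\<^sup>2"
    using mult_right_mono[OF y, of "2 * r"] r by (simp add: algebra_simps)
  \<comment> \<open>\<open>g\<close> is what remains once \<open>k\<close> is eliminated; the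
    factorisation of \<open>g r - g c\<close> shows that the worst radius is
    \<open>?c\<close>.\<close>
  define g where "g x = 1 - 4 * \<rho> * x + 4 * \<rho>\<^sup>2 * x\<^sup>2 - 2 * x + 2 * x * \<rho>\<^sup>2" for x :: real
  have "g r - g c = (c - r) * (4 * \<rho> + 2 - 2 * \<rho>\<^sup>2 - 4 * \<rho>\<^sup>2 * (r + c))" for c
    by (simp add: g_def power2_eq_square algebra_simps)
  then have "g r - g ?c = (?c - r) * (4 * \<rho> + 2 - 2 * \<rho>\<^sup>2 - 4 * \<rho>\<^sup>2 * (r + ?c))" .
  moreover have "\<dots> \<ge> 0"
  proof (rule mult_nonneg_nonneg)
    have p1: "\<rho>\<^sup>2 \<le> \<rho>" using \<rho> by (simp add: power2_eq_square mult_left_le)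
    have "4 * \<rho>\<^sup>2 * (r + ?c) \<le> 4 * \<rho>\<^sup>2 * (1/2)" using r by (intro mult_left_mono) auto
    then show "0 \<le> 4 * \<rho> + 2 - 2 * \<rho>\<^sup>2 - 4 * \<rho>\<^sup>2 * (r + ?c)" using p1 by linarith
  qed (use r in simp)
  moreover have "g ?c = 532/1000 - 936/1000 * \<rho> + 687024/1000000 * \<rho>\<^sup>2"
    by (simp add: g_def power2_eq_square algebra_simps)
  \<comment> \<open>\<open>681/1000\<close> is close to the minimiser of \<open>g ?c\<close> in
    \<open>\<rho>\<close>. The minimum must exceed \<open>5766/100000\<close>, from the cubic term,
    plus \<open>14404/100000\<close>, twice the tail bound used in
    \<open>convex_in_disk_sec_p\<close>.\<close>
  moreover have "687024/1000000 * (\<rho> - 681/1000)\<^sup>2 \<ge> 0" by simp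
  then have "687024/1000000 * \<rho>\<^sup>2 - 935726688/1000000000 * \<rho> + 3187/10000 \<ge> 0"
    by (simp add: power2_eq_square algebra_simps)
  ultimately have "g r > 5766/100000 + 14404/100000" using \<rho> by linarith
  moreover have "1 - 4 * (\<rho> * r) + 4 * (\<rho> * r)\<^sup>2 = g r + (2 * r - 2 * r * \<rho>\<^sup>2)"
    by (simp add: g_def power2_eq_square algebra_simps)
  ultimately show ?thesis using k r3 y' by linarith
qed

section \<open>The two families of sections\<close>

lemma sec_pq_altdef:
  "sec_pq p q h g = (\<lambda>z. z + (\<Sum>k=2..p. taylor_coef h k * z ^ k) + cnj (\<Sum>k=2..q. taylor_coef g k * z ^ k))"
  by (auto simp: sec_pq_def sec_h_def sec_g_def)

locale W_H0_map =
  fixes \<alpha> \<beta> :: real and h g :: "complex \<Rightarrow> complex"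
  assumes \<alpha>: "0 \<le> \<alpha>" and \<beta>: "0 \<le> \<beta>" "\<beta> < 1" and W: "W_H0 \<alpha> \<beta> h g"

sublocale W_H0_map \<subseteq> dominated_pair "deriv h" "deriv g" \<beta>
  using W W_H0_deriv_bound[OF W \<alpha>]
  by unfold_locales (auto simp: W_H0_def harmonic_H0_def intro: holomorphic_deriv less_imp_le)

context W_H0_map
begin

lemma coef_deriv: "k > 0 \<Longrightarrow> of_nat k * taylor_coef f k = taylor_coef (deriv f) (k - 1)"
  using taylor_coef_deriv[of f "k - 1"] by simp

lemma norm_coef_deriv: "k > 0 \<Longrightarrow> real k * cmod (taylor_coef f k) = cmod (taylor_coef (deriv f) (k - 1))"
  using arg_cong[OF coef_deriv[of k f], of cmod] by (simp add: norm_mult)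

text \<open>One factor of \<open>k\<^sup>2\<close> passes to the derivatives, since
  \<open>k * taylor_coef g k\<close> is coefficient \<open>k - 1\<close> of \<open>g'\<close>; the
  coefficient criterion then becomes \<open>coef_sum_less_1\<close>.\<close>

lemma convex_in_disk_sec_2:
  assumes R: "smallest_root_01 (P1 \<beta>) R"
  shows "convex_in_disk (sec_pq 2 q h g) R"
  unfolding sec_pq_altdef
proof (rule convex_in_disk_of_coef_sum)
  fix r assume r: "0 \<le> r" "r < R"
  have "(\<Sum>k=2..q. (real k)\<^sup>2 * cmod (taylor_coef g k) * r ^ (k - 1))
      = (\<Sum>k=2..q. real k * cmod (taylor_coef (deriv g) (k - 1)) * r ^ (k - 1))"
  proof (intro sum.cong refl)
    fix k assume "k \<in> {2..q}"
    then have "real k * cmod (taylor_coef g k) = cmod (taylor_coef (deriv g) (k - 1))"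
      by (intro norm_coef_deriv) auto
    then show "(real k)\<^sup>2 * cmod (taylor_coef g k) * r ^ (k - 1) = real k * cmod (taylor_coef (deriv g) (k - 1)) * r ^ (k - 1)"
      by (simp only: power2_eq_square mult.assoc)
  qed
  moreover have "(\<Sum>k=2..2. (real k)\<^sup>2 * cmod (taylor_coef h k) * r ^ (k - 1)) = 2 * cmod (taylor_coef (deriv h) 1) * r"
  proof -
    have "cmod (taylor_coef (deriv h) 1) = 2 * cmod (taylor_coef h 2)"
      using norm_coef_deriv[of 2 h] by simp
    then show ?thesis by simp
  qed
  ultimately show "(\<Sum>k=2..2. (real k)\<^sup>2 * cmod (taylor_coef h k) * r ^ (k - 1))
      + (\<Sum>k=2..q. (real k)\<^sup>2 * cmod (taylor_coef g k) * r ^ (k - 1)) < 1"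
    using coef_sum_less_1[OF \<beta> r R, of q] by linarith
qed

text \<open>For coefficients of \<open>h'\<close> of modulus \<open>2\<close> the criterion
  \<open>convex_in_disk_of_coef_sum\<close> fails for long sections beyond \<open>r = 0.184\<close>,
  short of \<open>0.234\<close>. So the phases of the first two terms are kept, and only the rest is
  estimated by moduli.\<close>

lemma convex_in_disk_sec_p:
  assumes p: "p > 2" and R: "smallest_root_01 (P2 \<beta>) R"
  shows "convex_in_disk (sec_pq p 2 h g) R"
  unfolding sec_pq_altdef
proof (rule convex_in_disk_polynomial)
  interpret zero: dominated_pair "deriv h" "deriv g" 0
    by (rule dominated_pair_0[OF \<beta>(1)])
  define P where "P n = taylor_coef (deriv h) n" for n
  define Q where "Q = taylor_coef (deriv g) 1"
  have hk: "of_nat k * taylor_coef h k = P (k - 1)" if "k \<ge> 2" for k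
    using coef_deriv[of k h] that by (simp add: P_def)
  have g2: "2 * taylor_coef g 2 = Q" using coef_deriv[of 2 g] by (simp add: Q_def)
  have PQ: "cmod (P 1) + cmod Q \<le> 2" using zero.sum_coef_bound[of 1] by (simp add: P_def Q_def)
  have P_le: "cmod (P n) \<le> 2" if "n > 0" for n
  proof -
    have "cmod (P n) + cmod (taylor_coef (deriv g) n) \<le> 2" using zero.sum_coef_bound[OF that] by (simp add: P_def)
    then show ?thesis using norm_ge_zero[of "taylor_coef (deriv g) n"] by linarith
  qed
  fix z :: complex assume z: "z \<in> ball 0 R"
  define r where "r = cmod z"
  have r: "0 \<le> r" "r \<le> 234/1000" using z P2_root_le[OF \<beta>(1) R] by (auto simp: r_def)
  have tail: "(\<Sum>k=Suc m..p. real k * r ^ (k - 1)) \<le> 1 / (766/1000)\<^sup>2 - (\<Sum>k=1..m. real k * (234/1000) ^ (k - 1))" for m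
  proof -
    have "(\<Sum>k=Suc m..p. real k * r ^ (k - 1)) \<le> (\<Sum>k=Suc m..p. real k * (234/1000) ^ (k - 1))"
      using r by (intro sum_mono mult_left_mono power_mono) auto
    also have "\<dots> \<le> 1 / (766/1000)\<^sup>2 - (\<Sum>k=1..m. real k * (234/1000) ^ (k - 1))"
      using sum_deriv_geometric_tail_le[of "234/1000" m p] by simp
    finally show ?thesis .
  qed
  have t3: "(\<Sum>k=3..p. real k * r ^ (k - 1)) \<le> 2363/10000"
    using tail[of 2] by (simp add: eval_nat_numeral)
  have t4: "(\<Sum>k=4..p. real k * r ^ (k - 1)) \<le> 7202/100000"
    using tail[of 3] by (simp add: eval_nat_numeral)
  have split2: "(\<Sum>k=2..p. f k) = f 2 + (\<Sum>k=3..p. f k)" for f :: "nat \<Rightarrow> complex"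
    using p sum.atLeast_Suc_atMost[of 2 p f] by (simp add: eval_nat_numeral)
  have split3: "(\<Sum>k=3..p. f k) = f 3 + (\<Sum>k=4..p. f k)" for f :: "nat \<Rightarrow> complex"
    using p sum.atLeast_Suc_atMost[of 3 p f] by (simp add: eval_nat_numeral)
  \<comment> \<open>The linear terms contribute at most \<open>2 * 0.234\<close> and the others at
    most \<open>2 * 0.2363\<close>, less than \<open>1\<close> in total.\<close>
  show "cmod (\<Sum>k=2..2. of_nat k * taylor_coef g k * z ^ (k - 1))
      < Re (1 + (\<Sum>k=2..p. of_nat k * taylor_coef h k * z ^ (k - 1)))"
  proof -
    have g_sum: "cmod (\<Sum>k=2..2. of_nat k * taylor_coef g k * z ^ (k - 1)) = cmod Q * r"
      using g2 by (simp add: norm_mult r_def flip: g2)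
    have h_sum: "(\<Sum>k=2..p. of_nat k * taylor_coef h k * z ^ (k - 1)) = P 1 * z + (\<Sum>k=3..p. P (k - 1) * z ^ (k - 1))"
      unfolding split2 using hk[of 2] hk by simp
    have "cmod (\<Sum>k=3..p. P (k - 1) * z ^ (k - 1)) \<le> 2 * (\<Sum>k=3..p. real k * r ^ (k - 1))"
      unfolding sum_distrib_left
    proof (intro order_trans[OF norm_sum] sum_mono)
      fix k assume k: "k \<in> {3..p}"
      have "cmod (P (k - 1)) * r ^ (k - 1) \<le> 2 * r ^ (k - 1)"
        using P_le[of "k - 1"] k r by (intro mult_right_mono) auto
      also have "\<dots> \<le> 2 * (real k * r ^ (k - 1))"
        using k r mult_right_mono[of 1 "real k" "r ^ (k - 1)"] by simp
      finally show "cmod (P (k - 1) * z ^ (k - 1)) \<le> 2 * (real k * r ^ (k - 1))"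
        by (simp add: norm_mult norm_power r_def)
    qed
    moreover have "cmod (P 1) * r + cmod Q * r \<le> 2 * (234/1000)"
    proof -
      have "(cmod (P 1) + cmod Q) * r \<le> 2 * (234/1000)" using PQ r by (intro mult_mono) auto
      then show ?thesis by (simp add: algebra_simps)
    qed
    moreover have "- cmod (P 1 * z + (\<Sum>k=3..p. P (k - 1) * z ^ (k - 1))) \<le> Re (P 1 * z + (\<Sum>k=3..p. P (k - 1) * z ^ (k - 1)))"
      using abs_Re_le_cmod[of "P 1 * z + (\<Sum>k=3..p. P (k - 1) * z ^ (k - 1))"] by linarith
    moreover have "cmod (P 1 * z + (\<Sum>k=3..p. P (k - 1) * z ^ (k - 1))) \<le> cmod (P 1) * r + cmod (\<Sum>k=3..p. P (k - 1) * z ^ (k - 1))"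
      using norm_triangle_ineq[of "P 1 * z"] by (simp add: norm_mult r_def)
    ultimately show ?thesis using t3 unfolding h_sum g_sum plus_complex.sel one_complex.sel by linarith
  qed
  assume "z \<noteq> 0"
  then have r0: "r > 0" by (simp add: r_def)
  \<comment> \<open>In terms of \<open>a\<close> and \<open>b\<close>, the first two terms split
    into a polynomial in \<open>v = a * z\<close>, treated by \<open>quadratic_norm_bound\<close>,
    and a multiple of \<open>b\<close>, which is balanced against \<open>Q\<close> by
    \<open>curvature_estimate\<close>.\<close>
  obtain a b where ab: "P 1 = 2 * a" "P 2 = 2 * b + 2 * a\<^sup>2" "cmod Q \<le> 1 - (cmod a)\<^sup>2 - (cmod b)\<^sup>2"
    using zero.second_order_coefs unfolding P_def Q_def by (metis (no_types, lifting))
  have "(cmod a)\<^sup>2 \<le> 1" using ab(3) by (smt (verit) norm_ge_zero zero_le_power2)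
  then have a1: "cmod a \<le> 1" by (simp add: power2_le_iff_abs_le abs_square_le_1)
  define v where "v = a * z"
  have v: "cmod v = cmod a * r" by (simp add: v_def norm_mult r_def)
  have "cmod a * r \<le> 1 * (234/1000)" using a1 r by (intro mult_mono) auto
  then have quad: "1 - 4 * (cmod a * r) + 4 * (cmod a * r)\<^sup>2 \<le> cmod (1 + 3 * v + 4 * v\<^sup>2) - cmod (v + 2 * v\<^sup>2)"
    using quadratic_norm_bound[OF v] by simp
  define T1 where "T1 = (\<Sum>k=4..p. of_nat (k - 1) * P (k - 1) * z ^ k)"
  define T2 where "T2 = (\<Sum>k=4..p. of_nat (k + 1) * P (k - 1) * z ^ k)"
  have tailbd: "cmod (\<Sum>k=4..p. of_nat (c k) * P (k - 1) * z ^ k) \<le> (\<Sum>k=4..p. real (c k) * 2 * r ^ k)" for c :: "nat \<Rightarrow> nat"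
    by (intro order_trans[OF norm_sum] sum_mono)
      (auto simp: norm_mult norm_power r_def intro!: mult_right_mono mult_left_mono P_le)
  \<comment> \<open>The weights add up to \<open>2 k\<close> and the coefficients of
    \<open>h'\<close> are at most \<open>2\<close>, whence the factor \<open>4\<close>.\<close>
  have T12: "cmod T1 + cmod T2 \<le> 4 * r * (7202/100000)"
  proof -
    have "cmod T1 + cmod T2 \<le> (\<Sum>k=4..p. real (k - 1) * 2 * r ^ k) + (\<Sum>k=4..p. real (k + 1) * 2 * r ^ k)"
      unfolding T1_def T2_def by (intro add_mono tailbd)
    also have "\<dots> = 4 * r * (\<Sum>k=4..p. real k * r ^ (k - 1))"
      unfolding sum.distrib[symmetric] sum_distrib_left
      by (intro sum.cong refl) (auto simp: power_eq_if[of r] of_nat_diff algebra_simps)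
    also have "\<dots> \<le> 4 * r * (7202/100000)" using t4 r by (intro mult_left_mono) auto
    finally show ?thesis .
  qed
  have c1: "of_nat (k * (k - 1)) * taylor_coef h k = of_nat (k - 1) * P (k - 1)"
    and c2: "of_nat (k * (k + 1)) * taylor_coef h k = of_nat (k + 1) * P (k - 1)" if "k \<ge> 2" for k
    unfolding hk[OF that, symmetric] by (simp_all only: of_nat_mult mult_ac)
  have A1: "(\<Sum>k=2..p. of_nat (k * (k - 1)) * taylor_coef h k * z ^ k) = z * (2 * (v + 2 * v\<^sup>2) + 4 * b * z\<^sup>2) + T1"
  proof -
    have "(\<Sum>k=2..p. of_nat (k * (k - 1)) * taylor_coef h k * z ^ k) = (\<Sum>k=2..p. of_nat (k - 1) * P (k - 1) * z ^ k)"
      by (intro sum.cong refl) (use c1 in simp)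
    also have "\<dots> = P 1 * z\<^sup>2 + 2 * P 2 * z ^ 3 + T1" unfolding split2 split3 T1_def by simp
    also have "P 1 * z\<^sup>2 + 2 * P 2 * z ^ 3 = z * (2 * (v + 2 * v\<^sup>2) + 4 * b * z\<^sup>2)"
      unfolding ab by (simp add: v_def power2_eq_square power3_eq_cube algebra_simps)
    finally show ?thesis .
  qed
  have A2: "(\<Sum>k=2..p. of_nat (k * (k + 1)) * taylor_coef h k * z ^ k) = z * (6 * v + 8 * v\<^sup>2 + 8 * b * z\<^sup>2) + T2"
  proof -
    have "(\<Sum>k=2..p. of_nat (k * (k + 1)) * taylor_coef h k * z ^ k) = (\<Sum>k=2..p. of_nat (k + 1) * P (k - 1) * z ^ k)"
      by (intro sum.cong refl) (use c2 in simp)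
    also have "\<dots> = 3 * P 1 * z\<^sup>2 + 4 * P 2 * z ^ 3 + T2" unfolding split2 split3 T2_def by simp
    also have "3 * P 1 * z\<^sup>2 + 4 * P 2 * z ^ 3 = z * (6 * v + 8 * v\<^sup>2 + 8 * b * z\<^sup>2)"
      unfolding ab by (simp add: v_def power2_eq_square power3_eq_cube algebra_simps)
    finally show ?thesis .
  qed
  have B1: "(\<Sum>k=2..2. of_nat (k * (k + 1)) * taylor_coef g k * z ^ k) = 3 * Q * z\<^sup>2"
    and B2: "(\<Sum>k=2..2. of_nat (k * (k - 1)) * taylor_coef g k * z ^ k) = Q * z\<^sup>2"
    by (simp_all flip: g2)
  have "6 * cmod b * r\<^sup>2 + 2 * cmod Q * r + 14404/100000 < cmod (1 + 3 * v + 4 * v\<^sup>2) - cmod (v + 2 * v\<^sup>2)"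
    using curvature_estimate[OF r0 r(2) norm_ge_zero a1 ab(3)] quad by linarith
  \<comment> \<open>The factors \<open>12 = 4 + 8\<close> and \<open>4 = 3 + 1\<close> collect the
    contributions of \<open>b\<close> and \<open>Q\<close> to the two sides of the curvature
    condition.\<close>
  from mult_strict_left_mono[OF this, of "2 * r"]
  have key: "12 * cmod b * r ^ 3 + 4 * cmod Q * r\<^sup>2 + 4 * r * (7202/100000)
      < 2 * r * cmod (1 + 3 * v + 4 * v\<^sup>2) - 2 * r * cmod (v + 2 * v\<^sup>2)"
    using r0 by (simp add: power2_eq_square power3_eq_cube algebra_simps)
  have "cmod (z * (2 * (v + 2 * v\<^sup>2) + 4 * b * z\<^sup>2) + T1 + cnj (3 * Q * z\<^sup>2))
      \<le> cmod (z * (2 * (v + 2 * v\<^sup>2))) + cmod (z * (4 * b * z\<^sup>2)) + cmod T1 + cmod (cnj (3 * Q * z\<^sup>2))"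
    unfolding distrib_left[of z] by (intro norm_triangle_mono norm_triangle_ineq order_refl)
  also have "\<dots> = 2 * r * cmod (v + 2 * v\<^sup>2) + 4 * cmod b * r ^ 3 + cmod T1 + 3 * cmod Q * r\<^sup>2"
    by (simp only: complex_mod_cnj norm_mult norm_power r_def[symmetric] norm_numeral)
      (simp add: power2_eq_square power3_eq_cube)
  also have "\<dots> < 2 * r * cmod (1 + 3 * v + 4 * v\<^sup>2) - 8 * cmod b * r ^ 3 - cmod T2 - cmod Q * r\<^sup>2"
    using key T12 by linarith
  also have "\<dots> = cmod (z * (2 * (1 + 3 * v + 4 * v\<^sup>2))) - cmod (z * (8 * b * z\<^sup>2)) - cmod T2 - cmod (cnj (Q * z\<^sup>2))"
    by (simp only: complex_mod_cnj norm_mult norm_power r_def[symmetric] norm_numeral)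
      (simp add: power2_eq_square power3_eq_cube)
  also have "\<dots> \<le> cmod (z * (2 * (1 + 3 * v + 4 * v\<^sup>2)) + z * (8 * b * z\<^sup>2) + T2 + cnj (Q * z\<^sup>2))"
    using norm_diff_ineq[of "z * (2 * (1 + 3 * v + 4 * v\<^sup>2))" "z * (8 * b * z\<^sup>2)"]
      norm_diff_ineq[of "z * (2 * (1 + 3 * v + 4 * v\<^sup>2)) + z * (8 * b * z\<^sup>2)" T2]
      norm_diff_ineq[of "z * (2 * (1 + 3 * v + 4 * v\<^sup>2)) + z * (8 * b * z\<^sup>2) + T2" "cnj (Q * z\<^sup>2)"]
    by linarith
  also have "z * (2 * (1 + 3 * v + 4 * v\<^sup>2)) + z * (8 * b * z\<^sup>2) = 2 * z + z * (6 * v + 8 * v\<^sup>2 + 8 * b * z\<^sup>2)"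
    by (simp add: algebra_simps)
  finally show "cmod ((\<Sum>k=2..p. of_nat (k * (k - 1)) * taylor_coef h k * z ^ k) + cnj (\<Sum>k=2..2. of_nat (k * (k + 1)) * taylor_coef g k * z ^ k))
      < cmod (2 * z + (\<Sum>k=2..p. of_nat (k * (k + 1)) * taylor_coef h k * z ^ k) + cnj (\<Sum>k=2..2. of_nat (k * (k - 1)) * taylor_coef g k * z ^ k))"
    unfolding A1 A2 B1 B2 by (simp only: add.assoc)
qed

end

theorem theorem5p2:
  fixes \<alpha> \<beta> :: real and h g :: "complex \<Rightarrow> complex"
  assumes "\<alpha> \<ge> 0" and "0 \<le> \<beta>" and "\<beta> < 1"
    and "W_H0 \<alpha> \<beta> h g"
  shows "(\<forall>(q::nat) R1. q > 2 \<and> smallest_root_01 (P1 \<beta>) R1 \<longrightarrow> convex_in_disk (sec_pq 2 q h g) R1)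
       \<and> (\<forall>(p::nat) R2. p > 2 \<and> smallest_root_01 (P2 \<beta>) R2 \<longrightarrow> convex_in_disk (sec_pq p 2 h g) R2)"
proof -
  interpret W_H0_map \<alpha> \<beta> h g
    using assms by unfold_locales
  show ?thesis using convex_in_disk_sec_2 convex_in_disk_sec_p by blast
qed

end
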